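(* Let $n\le m$ and let $\mathcal{F}=[c_1,\ldots,c_n]$ be an $m\times n$-Ferrers diagram. Then maximal $[\mathcal{F};n]$-codes are generic if and only if $(\mathcal{F};n)$ is MDS-constructible. In particular, maximal $[m\times n;n]$-MRD codes (i.e. maximal $[\mathcal{F};n]$-codes for the full diagram $\mathcal{F}=[m]\times[n]$) are not generic whenever $n>1$. Moreover, if $(\mathcal{F};n)$ is MDS-constructible then $\nu_{\min}(\mathcal{F};n)=1$ or $\nu_{\min}(\mathcal{F};n)=\nu_0(\mathcal{F};n)=c_1<\nu_j(\mathcal{F};n)$ for all $j>0$ (that is, $j\in\{1,\ldots,n-1\}$).
   Context: $[n]=\{1,\ldots,n\}$. An $m\times n$-Ferrers diagram is a set $\mathcal{F}\subseteq[m]\times[n]$ such that $(i,j)\in\mathcal{F}$, $j<n$ implies $(i,j+1)\in\mathcal{F}$, and $(i,j)\in\mathcal{F}$, $i>1$ implies $(i-1,j)\in\mathcal{F}$. It is identified with $[c_1,\ldots,c_n]$, where $c_j$ is the number of elements of $\mathcal{F}$ in column $j$. $\mathbb{F}_q[\mathcal{F}]$ is the space of matrices in $\mathbb{F}_q^{m\times n}$ whose nonzero entries occur only at positions in $\mathcal{F}$. The rank distance of a subspace of matrices is the minimum rank of its nonzero elements. For $\delta\in[n]$ and $j=0,\ldots,\delta-1$ put $\nu_j(\mathcal{F};\delta)=\sum_{t=1}^{n-\delta+1+j}\max\{c_t-j,0\}$ and $\nu_{\min}(\mathcal{F};\delta)=\min\{\nu_0,\ldots,\nu_{\delta-1}\}$.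 A maximal $[\mathcal{F};\delta]_q$-code is a subspace of $\mathbb{F}_q[\mathcal{F}]$ of rank distance $\delta$ and dimension $\nu_{\min}(\mathcal{F};\delta)$. Let $T_q$ be the set of all subspaces of $\mathbb{F}_q[\mathcal{F}]$ of dimension $\nu_{\min}(\mathcal{F};\delta)$ and $\hat T_q\subseteq T_q$ the subset of maximal $[\mathcal{F};\delta]_q$-codes. Maximal $[\mathcal{F};\delta]$-codes are generic if $\lim_{q\to\infty}|\hat T_q|/|T_q|=1$ ($q$ running over all prime powers). For $r\in[m]$ let $D_r=\{(i,j)\in[m]\times[n]\mid j-i=n-r\}$. The pair $(\mathcal{F};\delta)$ is MDS-constructible if $\nu_{\min}(\mathcal{F};\delta)=\sum_{i=1}^m\max\{|D_i\cap\mathcal{F}|-\delta+1,0\}$.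
   Formalization: The "Moreover" clause is stated only for ν_min(F;n) > 0, since it fails for F = [1,1,1], m = n = 3, where ν_min = 0; and when ν_min = 0 the zero code, whose rank distance is undefined, is counted as a maximal code. *)

theory Defs
  imports Complex_Main "Jordan_Normal_Form.Missing_VectorSpace"
begin

section \<open>Ferrers diagrams\<close>

text \<open>Positions are pairs (row, column), both counted from 1.\<close>

definition ferrers_diagram :: "nat \<Rightarrow> nat \<Rightarrow> (nat \<times> nat) set \<Rightarrow> bool" where
  "ferrers_diagram m n F \<longleftrightarrow>
     F \<subseteq> {1..m} \<times> {1..n} \<and>
     (\<forall>i j. (i, j) \<in> F \<and> j < n \<longrightarrow> (i, j + 1) \<in> F) \<and>
     (\<forall>i j. (i, j) \<in> F \<and> i > 1 \<longrightarrow> (i - 1, j) \<in> F)"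

definition col_count :: "(nat \<times> nat) set \<Rightarrow> nat \<Rightarrow> nat" where
  "col_count F t = card {i. (i, t) \<in> F}"

text \<open>Truncated subtraction on \<^typ>\<open>nat\<close> is exactly $\max\{c_t - j, 0\}$.\<close>

definition nu :: "nat \<Rightarrow> (nat \<times> nat) set \<Rightarrow> nat \<Rightarrow> nat \<Rightarrow> nat" where
  "nu n F \<delta> j = (\<Sum>t = 1..n - \<delta> + 1 + j. col_count F t - j)"

definition nu_min :: "nat \<Rightarrow> (nat \<times> nat) set \<Rightarrow> nat \<Rightarrow> nat" where
  "nu_min n F \<delta> = Min (nu n F \<delta> ` {0..\<delta> - 1})"

definition diagonal :: "nat \<Rightarrow> nat \<Rightarrow> nat \<Rightarrow> (nat \<times> nat) set" where
  "diagonal m n r = {(i, j) \<in> {1..m} \<times> {1..n}. int j - int i = int n - int r}"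

text \<open>Adding 1 before the truncated subtraction makes the summand
  $\max\{|D_i \cap F| - \delta + 1, 0\}$.\<close>

definition mds_constructible :: "nat \<Rightarrow> nat \<Rightarrow> (nat \<times> nat) set \<Rightarrow> nat \<Rightarrow> bool" where
  "mds_constructible m n F \<delta> \<longleftrightarrow>
     nu_min n F \<delta> = (\<Sum>i = 1..m. card (diagonal m n i \<inter> F) + 1 - \<delta>)"

section \<open>Matrix codes over a field\<close>

text \<open>Matrices are (extensional) functions on the index set, so that the space of matrices is the
  vector space of functions provided by the library.\<close>

definition mat_space :: "('a, 'b) ring_scheme \<Rightarrow> nat \<Rightarrow> nat \<Rightarrow> ('a, nat \<times> nat \<Rightarrow> 'a) module" where
  "mat_space K m n = ring.func_space K ({1..m} \<times> {1..n})"

definition shape_space ::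
    "('a, 'b) ring_scheme \<Rightarrow> nat \<Rightarrow> nat \<Rightarrow> (nat \<times> nat) set \<Rightarrow> (nat \<times> nat \<Rightarrow> 'a) set" where
  "shape_space K m n F =
     {A \<in> carrier (mat_space K m n). \<forall>p \<in> {1..m} \<times> {1..n}. A p \<noteq> \<zero>\<^bsub>K\<^esub> \<longrightarrow> p \<in> F}"

definition subspace_dim :: "('a, 'b) ring_scheme \<Rightarrow> ('a, 'v, 'c) module_scheme \<Rightarrow> 'v set \<Rightarrow> nat" where
  "subspace_dim K V W = vectorspace.dim K (V\<lparr>carrier := W\<rparr>)"

definition column :: "nat \<Rightarrow> (nat \<times> nat \<Rightarrow> 'a) \<Rightarrow> nat \<Rightarrow> nat \<Rightarrow> 'a" where
  "column m A j = (\<lambda>i\<in>{1..m}. A (i, j))"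

definition mat_rank :: "('a, 'b) ring_scheme \<Rightarrow> nat \<Rightarrow> nat \<Rightarrow> (nat \<times> nat \<Rightarrow> 'a) \<Rightarrow> nat" where
  "mat_rank K m n A =
     (let V = ring.func_space K {1..m}
      in subspace_dim K V (module.span K V (column m A ` {1..n})))"

text \<open>Unspecified for the zero code, which has no nonzero elements.\<close>

definition rank_distance ::
    "('a, 'b) ring_scheme \<Rightarrow> nat \<Rightarrow> nat \<Rightarrow> (nat \<times> nat \<Rightarrow> 'a) set \<Rightarrow> nat" where
  "rank_distance K m n C = Min (mat_rank K m n ` (C - {\<zero>\<^bsub>mat_space K m n\<^esub>}))"

definition shape_subspaces ::
    "('a, 'b) ring_scheme \<Rightarrow> nat \<Rightarrow> nat \<Rightarrow> (nat \<times> nat) set \<Rightarrow> nat \<Rightarrow> (nat \<times> nat \<Rightarrow> 'a) set set" where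
  "shape_subspaces K m n F \<delta> =
     {C. subspace K C (mat_space K m n) \<and> C \<subseteq> shape_space K m n F \<and>
         subspace_dim K (mat_space K m n) C = nu_min n F \<delta>}"

text \<open>If \<^term>\<open>nu_min n F \<delta> = 0\<close>, the only candidate is the zero code. By convention it is
  counted as a maximal code. If \<^term>\<open>nu_min n F \<delta> > 0\<close>, the zero code does not occur.\<close>

definition maximal_codes ::
    "('a, 'b) ring_scheme \<Rightarrow> nat \<Rightarrow> nat \<Rightarrow> (nat \<times> nat) set \<Rightarrow> nat \<Rightarrow> (nat \<times> nat \<Rightarrow> 'a) set set" where
  "maximal_codes K m n F \<delta> =
     {C \<in> shape_subspaces K m n F \<delta>.
        C \<noteq> {\<zero>\<^bsub>mat_space K m n\<^esub>} \<longrightarrow> rank_distance K m n C = \<delta>}"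

section \<open>Genericity\<close>

text \<open>The limit over all prime powers $q$ is taken over all finite fields, ordered by
  cardinality: the counts depend on the field only up to isomorphism, i.e. only on $q$, and every
  finite field is isomorphic to one whose elements are natural numbers.\<close>

definition finite_fields :: "nat ring set" where
  "finite_fields = {K. field K \<and> finite (carrier K)}"

definition generic :: "nat \<Rightarrow> nat \<Rightarrow> (nat \<times> nat) set \<Rightarrow> nat \<Rightarrow> bool" where
  "generic m n F \<delta> \<longleftrightarrow>
     ((\<lambda>K :: nat ring. real (card (maximal_codes K m n F \<delta>)) / real (card (shape_subspaces K m n F \<delta>)))
        \<longlongrightarrow> 1) (inf (filtercomap order at_top) (principal finite_fields))"

lemma generic_iff:
  "generic m n F \<delta> \<longleftrightarrow>
     (\<forall>\<epsilon>>0. \<exists>N. \<forall>K :: nat ring. field K \<and> finite (carrier K) \<and> N \<le> order K \<longrightarrow>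
        \<bar>real (card (maximal_codes K m n F \<delta>)) / real (card (shape_subspaces K m n F \<delta>)) - 1\<bar> < \<epsilon>)"
  unfolding generic_def tendsto_iff eventually_inf_principal eventually_filtercomap
    eventually_at_top_linorder finite_fields_def dist_real_def mem_Collect_eq
  by (intro all_cong1 imp_cong refl) blast

end

theory Submission
  imports Defs "HOL-Algebra.Weak_Morphisms" "HOL-Number_Theory.Residues"
begin

text \<open>
  Let \<open>q\<close> be the field size, \<open>N = nu_min n F n\<close>, and \<open>h\<close> the minimum of \<open>c(j+1) - j\<close> over \<open>j < n\<close>, where
  \<open>c\<close> counts the cells of a column. Exactly \<open>h\<close> of the diagonals \<open>D\<^sub>i\<close> lie in \<open>F\<close> with all \<open>n\<close> cells, so
  MDS-constructibility means \<open>N = h\<close>, and always \<open>h \<le> N\<close>. Choosing the columns one after the other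
  shows that a random matrix of shape \<open>F\<close> has rank \<open>n\<close> with probability equal to the product of the
  factors \<open>1 - q\<^bsup>t\<^esup> / q\<^bsup>c(t+1)\<^esup>\<close> for \<open>t < n\<close>, so the rank-deficient matrices have density of order
  \<open>q\<^bsup>-h\<^esup>\<close>. A random \<open>N\<close>-dimensional subspace therefore contains on average about \<open>q\<^bsup>N-1-h\<^esup>\<close> deficient
  lines. If \<open>N = h\<close>, this tends to \<open>0\<close>, and the first moment method applies. If \<open>N > h\<close>, it is at least
  \<open>1/4\<close>, and the second moment method bounds the probability of containing such a line from below
  by \<open>1/5\<close>.
\<close>

section \<open>Counting in finite vector spaces\<close>

locale finite_vectorspace = vectorspace K V for K (structure) and V (structure) +
  assumes finite_scalars [simp]: "finite (carrier K)"
    and finite_vectors [simp]: "finite (carrier V)"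
begin

lemma finite_subset_vectors: "W \<subseteq> carrier V \<Longrightarrow> finite W"
  using finite_subset finite_vectors by blast

lemma order_ge_2: "2 \<le> order K"
proof -
  have "card {\<zero>\<^bsub>K\<^esub>, \<one>\<^bsub>K\<^esub>} \<le> card (carrier K)"
    by (intro card_mono) auto
  then show ?thesis by (simp add: order_def)
qed

text \<open>Coordinates with respect to a finite basis \<open>A\<close> identify the space with
  \<open>A \<rightarrow>\<^sub>E carrier K\<close>; extensionality makes the coordinate function
  unique.\<close>

lemma card_eq_order_power_dim: "card (carrier V) = order K ^ dim"
proof -
  have "span (carrier V) = carrier V"
    by (intro equalityI span_is_subset2 subsetI span_mem) auto
  then have "fin_dim" unfolding fin_dim_def by (intro exI[of _ "carrier V"]) auto
  then obtain A where A: "finite A" "basis A" using finite_basis_exists by blast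
  have AV: "A \<subseteq> carrier V" using A(2) by (simp add: basis_def)
  have ex1: "\<exists>!a. a \<in> A \<rightarrow>\<^sub>E carrier K \<and> lincomb a A = v" if "v \<in> carrier V" for v
    using basis_criterion[OF A(1) AV] A(2) that by blast
  have "bij_betw (\<lambda>a. lincomb a A) (A \<rightarrow>\<^sub>E carrier K) (carrier V)"
  proof (rule bij_betw_imageI)
    show "inj_on (\<lambda>a. lincomb a A) (A \<rightarrow>\<^sub>E carrier K)"
    proof (rule inj_onI)
      fix a b assume ab: "a \<in> A \<rightarrow>\<^sub>E carrier K" "b \<in> A \<rightarrow>\<^sub>E carrier K" "lincomb a A = lincomb b A"
      have "lincomb a A \<in> carrier V" by (rule lincomb_closed[OF AV]) (use ab(1) in auto)
      from ex1[OF this] show "a = b" using ab by metis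
    qed
    show "(\<lambda>a. lincomb a A) ` (A \<rightarrow>\<^sub>E carrier K) = carrier V"
    proof (intro equalityI subsetI)
      fix v assume "v \<in> carrier V"
      then obtain a where "a \<in> A \<rightarrow>\<^sub>E carrier K" "lincomb a A = v" using ex1 by blast
      then show "v \<in> (\<lambda>a. lincomb a A) ` (A \<rightarrow>\<^sub>E carrier K)" by blast
    next
      fix v assume "v \<in> (\<lambda>a. lincomb a A) ` (A \<rightarrow>\<^sub>E carrier K)"
      then obtain a where "a \<in> A \<rightarrow>\<^sub>E carrier K" "v = lincomb a A" by blast
      then show "v \<in> carrier V" using AV lincomb_closed[of A a] by blast
    qed
  qed
  then have "card (carrier V) = card (A \<rightarrow>\<^sub>E carrier K)" by (rule bij_betw_same_card[symmetric])
  also have "\<dots> = order K ^ card A" using A(1) by (simp add: card_PiE order_def)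
  finally show ?thesis using dim_basis[OF A] by simp
qed

text \<open>Trades dimensions for cardinalities, so that everything later is counting. Since
  \<open>2 \<le> order K\<close>, the exponent is unique.\<close>

lemma subspace_dim_eq_iff:
  assumes "subspace K W V"
  shows "subspace_dim K V W = d \<longleftrightarrow> card W = order K ^ d"
proof -
  interpret S: vectorspace K "vs W" using assms by (rule subspace_is_vs)
  have "W \<subseteq> carrier V" using assms by (auto simp: subspace_def submodule_def)
  then interpret S: finite_vectorspace K "vs W"
    by unfold_locales (auto intro: finite_subset_vectors)
  have "card W = order K ^ subspace_dim K V W"
    using S.card_eq_order_power_dim by (simp add: subspace_dim_def)
  then show ?thesis using order_ge_2 by simp
qed

lemma subspaceD:
  assumes "subspace K W V"
  shows "W \<subseteq> carrier V" "\<zero>\<^bsub>V\<^esub> \<in> W"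
    "\<And>v w. v \<in> W \<Longrightarrow> w \<in> W \<Longrightarrow> v \<oplus>\<^bsub>V\<^esub> w \<in> W"
    "\<And>a v. a \<in> carrier K \<Longrightarrow> v \<in> W \<Longrightarrow> a \<odot>\<^bsub>V\<^esub> v \<in> W"
proof -
  have W: "submodule K W V" using assms by (simp add: subspace_def)
  interpret submodule K W V by (rule W)
  show "W \<subseteq> carrier V" "\<zero>\<^bsub>V\<^esub> \<in> W"
    "\<And>v w. v \<in> W \<Longrightarrow> w \<in> W \<Longrightarrow> v \<oplus>\<^bsub>V\<^esub> w \<in> W"
    "\<And>a v. a \<in> carrier K \<Longrightarrow> v \<in> W \<Longrightarrow> a \<odot>\<^bsub>V\<^esub> v \<in> W"
    using W by (auto simp: submodule_def)
qed

lemma subspaceI: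
  assumes "W \<subseteq> carrier V" "\<zero>\<^bsub>V\<^esub> \<in> W"
    "\<And>v w. v \<in> W \<Longrightarrow> w \<in> W \<Longrightarrow> v \<oplus>\<^bsub>V\<^esub> w \<in> W"
    "\<And>a v. a \<in> carrier K \<Longrightarrow> v \<in> W \<Longrightarrow> a \<odot>\<^bsub>V\<^esub> v \<in> W"
  shows "subspace K W V"
  using assms module_axioms vectorspace_axioms
  by (auto simp: subspace_def submodule_def vectorspace_def)

lemma span_subset_subspace:
  assumes "subspace K W V" "S \<subseteq> W"
  shows "span S \<subseteq> W"
  using assms span_is_subset[of S W] by (simp add: subspace_def)

lemma span_subspace: "subspace K W V \<Longrightarrow> span W = W"
  using span_subset_subspace[of W W] span_mem[of W] subspaceD(1)[of W] by blast

lemma span_insert_eq: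
  assumes S: "S \<subseteq> carrier V" and v: "v \<in> carrier V"
  shows "span (insert v S) = (\<lambda>(a, w). a \<odot>\<^bsub>V\<^esub> v \<oplus>\<^bsub>V\<^esub> w) ` (carrier K \<times> span S)" (is "_ = ?R")
proof
  have sS: "subspace K (span S) V" using span_is_subspace[OF S] .
  note D = subspaceD[OF sS]
  have "subspace K ?R V"
  proof (rule subspaceI)
    show "?R \<subseteq> carrier V" using D(1) v by auto
    have "\<zero>\<^bsub>V\<^esub> = \<zero>\<^bsub>K\<^esub> \<odot>\<^bsub>V\<^esub> v \<oplus>\<^bsub>V\<^esub> \<zero>\<^bsub>V\<^esub>" using v by simp
    then show "\<zero>\<^bsub>V\<^esub> \<in> ?R" using D(2) by (intro image_eqI[of _ _ "(\<zero>\<^bsub>K\<^esub>, \<zero>\<^bsub>V\<^esub>)"]) auto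
  next
    fix x y assume "x \<in> ?R" "y \<in> ?R"
    then obtain a u b w where x: "a \<in> carrier K" "u \<in> span S" "x = a \<odot>\<^bsub>V\<^esub> v \<oplus>\<^bsub>V\<^esub> u"
      and y: "b \<in> carrier K" "w \<in> span S" "y = b \<odot>\<^bsub>V\<^esub> v \<oplus>\<^bsub>V\<^esub> w" by auto
    have c: "u \<in> carrier V" "w \<in> carrier V" using x y D(1) by auto
    have "x \<oplus>\<^bsub>V\<^esub> y = (a \<oplus>\<^bsub>K\<^esub> b) \<odot>\<^bsub>V\<^esub> v \<oplus>\<^bsub>V\<^esub> (u \<oplus>\<^bsub>V\<^esub> w)"
      using x y c v by (simp add: smult_l_distr M.a_ac)
    then show "x \<oplus>\<^bsub>V\<^esub> y \<in> ?R" using x y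
      by (intro image_eqI[of _ _ "(a \<oplus>\<^bsub>K\<^esub> b, u \<oplus>\<^bsub>V\<^esub> w)"]) (auto intro: D(3))
  next
    fix c x assume c: "c \<in> carrier K" and "x \<in> ?R"
    then obtain a u where x: "a \<in> carrier K" "u \<in> span S" "x = a \<odot>\<^bsub>V\<^esub> v \<oplus>\<^bsub>V\<^esub> u" by auto
    have "u \<in> carrier V" using x D(1) by auto
    then have "c \<odot>\<^bsub>V\<^esub> x = (c \<otimes>\<^bsub>K\<^esub> a) \<odot>\<^bsub>V\<^esub> v \<oplus>\<^bsub>V\<^esub> c \<odot>\<^bsub>V\<^esub> u"
      using x v c by (simp add: smult_r_distr smult_assoc1)
    then show "c \<odot>\<^bsub>V\<^esub> x \<in> ?R" using x c
      by (intro image_eqI[of _ _ "(c \<otimes>\<^bsub>K\<^esub> a, c \<odot>\<^bsub>V\<^esub> u)"]) (auto intro: D(4))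
  qed
  moreover have "insert v S \<subseteq> ?R"
  proof -
    have "v \<in> ?R" using v D(2) by (intro image_eqI[of _ _ "(\<one>\<^bsub>K\<^esub>, \<zero>\<^bsub>V\<^esub>)"]) auto
    moreover have "s \<in> ?R" if "s \<in> S" for s
      using that v S span_mem[OF S] by (intro image_eqI[of _ _ "(\<zero>\<^bsub>K\<^esub>, s)"]) auto
    ultimately show ?thesis by auto
  qed
  ultimately show "span (insert v S) \<subseteq> ?R" by (rule span_subset_subspace)
next
  have I: "insert v S \<subseteq> carrier V" using assms by simp
  note D = subspaceD[OF span_is_subspace[OF I]]
  have "span S \<subseteq> span (insert v S)" by (intro span_is_monotone) auto
  then show "?R \<subseteq> span (insert v S)" using span_mem[OF I, of v] by (auto intro!: D(3,4))
qed

text \<open>The parametrisation from \<open>span_insert_eq\<close> is injective: two representations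
  with different coefficients of \<open>v\<close> would, after division by the difference, put
  \<open>v\<close> into \<open>span S\<close>.\<close>

lemma card_span_insert:
  assumes S: "S \<subseteq> carrier V" and v: "v \<in> carrier V" "v \<notin> span S"
  shows "card (span (insert v S)) = order K * card (span S)"
proof -
  note D = subspaceD[OF span_is_subspace[OF S]]
  have "inj_on (\<lambda>(a, w). a \<odot>\<^bsub>V\<^esub> v \<oplus>\<^bsub>V\<^esub> w) (carrier K \<times> span S)"
  proof (rule inj_onI, clarify)
    fix a u b w
    assume ab: "a \<in> carrier K" "b \<in> carrier K" and uw: "u \<in> span S" "w \<in> span S"
      and eq: "a \<odot>\<^bsub>V\<^esub> v \<oplus>\<^bsub>V\<^esub> u = b \<odot>\<^bsub>V\<^esub> v \<oplus>\<^bsub>V\<^esub> w"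
    have c: "u \<in> carrier V" "w \<in> carrier V" using D(1) uw by auto
    have "a = b"
    proof (rule ccontr)
      assume "a \<noteq> b"
      \<comment> \<open>The difference of \<open>a\<close> and \<open>b\<close>, arranged so that
        \<open>R.r_neg2\<close> recovers \<open>a\<close> from it.\<close>
      define c where "c = \<ominus>\<^bsub>K\<^esub> b \<oplus>\<^bsub>K\<^esub> a"
      have cK: "c \<in> carrier K" using ab by (simp add: c_def)
      have a: "a = b \<oplus>\<^bsub>K\<^esub> c" unfolding c_def by (rule R.r_neg2[OF ab(2,1), symmetric])
      have nz: "c \<noteq> \<zero>\<^bsub>K\<^esub>"
      proof
        assume "c = \<zero>\<^bsub>K\<^esub>"
        then show False using a R.r_zero[OF ab(2)] \<open>a \<noteq> b\<close> by metis
      qed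
      have "b \<odot>\<^bsub>V\<^esub> v \<oplus>\<^bsub>V\<^esub> (c \<odot>\<^bsub>V\<^esub> v \<oplus>\<^bsub>V\<^esub> u) = b \<odot>\<^bsub>V\<^esub> v \<oplus>\<^bsub>V\<^esub> w"
        using eq[unfolded a] smult_l_distr[OF ab(2) cK v(1)] ab cK v(1) c M.a_assoc[of "b \<odot>\<^bsub>V\<^esub> v" "c \<odot>\<^bsub>V\<^esub> v" u]
        by simp
      then have "c \<odot>\<^bsub>V\<^esub> v \<oplus>\<^bsub>V\<^esub> u = w" using ab cK v(1) c by simp
      then have "u \<oplus>\<^bsub>V\<^esub> c \<odot>\<^bsub>V\<^esub> v = w" using cK v(1) c by (simp add: M.a_comm)
      then have "c \<odot>\<^bsub>V\<^esub> v \<in> span S" using span_add[OF S uw(1), of "c \<odot>\<^bsub>V\<^esub> v"] uw(2) cK v(1) by simp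
      then have "inv\<^bsub>K\<^esub> c \<odot>\<^bsub>V\<^esub> (c \<odot>\<^bsub>V\<^esub> v) \<in> span S" using nz cK by (intro D(4)[of "inv\<^bsub>K\<^esub> c"]) (simp_all add: field_Units)
      then show False using mult_inverse[OF cK v(1) refl nz] v(2) by metis
    qed
    moreover from this have "u = w" using eq ab v c by simp
    ultimately show "a = b \<and> u = w" by blast
  qed
  then show ?thesis unfolding span_insert_eq[OF S v(1)]
    by (simp add: card_image card_cartesian_product order_def)
qed

section \<open>Gaussian binomial counts of subspaces\<close>

definition subspaces_in :: "'c set \<Rightarrow> nat \<Rightarrow> 'c set set" where
  "subspaces_in W N = {C. subspace K C V \<and> C \<subseteq> W \<and> card C = order K ^ N}"

lemma finite_subspaces_in: "W \<subseteq> carrier V \<Longrightarrow> finite (subspaces_in W N)"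
  by (rule finite_subset[of _ "Pow W"]) (auto simp: subspaces_in_def finite_subset_vectors)

lemma power_order_less: "i < j \<Longrightarrow> real (order K) ^ i < real (order K) ^ j"
  using order_ge_2 by simp

lemma power_order_le: "i \<le> j \<Longrightarrow> real (order K) ^ i \<le> real (order K) ^ j"
  using order_ge_2 by (simp add: power_increasing)

text \<open>The product is the Gaussian binomial coefficient for the dimensions \<open>L - k\<close>
  and \<open>N - k\<close>. In the downward induction on \<open>k\<close>, the pairs of a subspace
  \<open>C\<close> through \<open>U\<close> and a vector \<open>v\<close> of \<open>C - U\<close>
  are counted in two ways: by \<open>C\<close>, and by \<open>v\<close>, where adjoining
  \<open>v\<close> to \<open>U\<close> leads to the case \<open>Suc k\<close>.\<close>

lemma card_subspaces_between:
  assumes W: "subspace K W V" "card W = order K ^ L" and NL: "N \<le> L"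
    and U: "subspace K U V" "U \<subseteq> W" "card U = order K ^ k" and "k \<le> N"
  shows "real (card {C \<in> subspaces_in W N. U \<subseteq> C}) =
    (\<Prod>i = k..<N. (real (order K) ^ L - real (order K) ^ i) / (real (order K) ^ N - real (order K) ^ i))"
  using \<open>k \<le> N\<close> U
proof (induction k arbitrary: U rule: inc_induct)
  case base
  have "C = U" if "C \<in> subspaces_in W N" "U \<subseteq> C" for C
  proof -
    have "finite C" using that W subspaceD(1) finite_subset_vectors
      by (auto simp: subspaces_in_def)
    then show ?thesis using that base card_subset_eq[of C U] by (simp add: subspaces_in_def)
  qed
  then have "{C \<in> subspaces_in W N. U \<subseteq> C} = {U}"
    using base by (auto simp: subspaces_in_def)
  then show ?case by simp
next
  case (step k)
  let ?q = "real (order K)"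
  let ?T = "{C \<in> subspaces_in W N. U \<subseteq> C}"
  let ?f = "\<lambda>k. \<Prod>i = k..<N. (?q ^ L - ?q ^ i) / (?q ^ N - ?q ^ i)"
  have WV: "W \<subseteq> carrier V" using W(1) by (rule subspaceD)
  have fin: "finite ?T" "finite (W - U)"
    using finite_subspaces_in[OF WV] finite_subset_vectors[OF WV] by auto
  have UV: "U \<subseteq> carrier V" using step.prems(2) WV by blast
  have finU: "finite U" using UV by (rule finite_subset_vectors)
  have ext: "real (card {C \<in> ?T. v \<in> C}) = ?f (Suc k)" if v: "v \<in> W - U" for v
  proof -
    let ?U = "span (insert v U)"
    have vV: "v \<in> carrier V" "v \<notin> span U" using v WV span_subspace[OF step.prems(1)] by auto
    have I: "insert v U \<subseteq> carrier V" using UV vV by simp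
    have "card ?U = order K ^ Suc k"
      using card_span_insert[OF UV vV] step.prems span_subspace[OF step.prems(1)] by simp
    moreover have "?U \<subseteq> W" using v step.prems by (intro span_subset_subspace[OF W(1)]) auto
    moreover have "{C \<in> ?T. v \<in> C} = {C \<in> subspaces_in W N. ?U \<subseteq> C}"
      using span_mem[OF I] span_subset_subspace[of _ "insert v U"]
      by (fastforce simp: subspaces_in_def)
    ultimately show ?thesis using step.IH[OF span_is_subspace[OF I]] by simp
  qed
  have "(\<Sum>C\<in>?T. real (card (C - U))) = (\<Sum>C\<in>?T. real (card {v \<in> W - U. v \<in> C}))"
    by (intro sum.cong refl arg_cong[where f = card] arg_cong[where f = real])
      (auto simp: subspaces_in_def)
  also have "\<dots> = real (\<Sum>v\<in>W - U. card {C \<in> ?T. v \<in> C})"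
    using sum_multicount_gen[of ?T "W - U" "\<lambda>C v. v \<in> C" "\<lambda>v. card {C \<in> ?T. v \<in> C}"] fin
    by (simp flip: of_nat_sum)
  also have "\<dots> = real (card (W - U)) * ?f (Suc k)"
    using ext by simp
  also have "real (card (W - U)) = ?q ^ L - ?q ^ k"
  proof -
    have "order K ^ k \<le> order K ^ L"
      using step(1,2) NL order_ge_2 by (intro power_increasing) auto
    then show ?thesis
      using card_Diff_subset[OF finU step.prems(2)] W(2) step.prems(3) by (simp add: of_nat_diff)
  qed
  also have "(\<Sum>C\<in>?T. real (card (C - U))) = (\<Sum>C\<in>?T. ?q ^ N - ?q ^ k)"
  proof (rule sum.cong[OF refl])
    fix C assume C: "C \<in> ?T"
    have "order K ^ k \<le> order K ^ N"
      using step(1,2) order_ge_2 by (intro power_increasing) auto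
    then show "real (card (C - U)) = ?q ^ N - ?q ^ k"
      using card_Diff_subset[OF finU, of C] C step.prems(3)
      by (simp add: subspaces_in_def of_nat_diff)
  qed
  finally have "real (card ?T) * (?q ^ N - ?q ^ k) = (?q ^ L - ?q ^ k) * ?f (Suc k)" by simp
  moreover have "?q ^ N - ?q ^ k > 0" using power_order_less[of k N] step(2) by simp
  ultimately have "real (card ?T) = (?q ^ L - ?q ^ k) / (?q ^ N - ?q ^ k) * ?f (Suc k)"
    by (simp add: field_simps)
  then show ?case unfolding prod.atLeast_Suc_lessThan[OF step(2)] .
qed

end

section \<open>First and second moment bounds for random subspaces\<close>

locale nested_count = finite_vectorspace +
  fixes W and L N :: nat
  assumes W: "subspace K W V" "card W = order K ^ L" and NL: "1 \<le> N" "N \<le> L"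
begin

abbreviation "\<T> \<equiv> subspaces_in W N"
abbreviation "q \<equiv> real (order K)"

text \<open>The probability that a fixed nonzero vector of \<open>W\<close> lies in a uniformly
  random member of \<open>\<T>\<close>; see \<open>card_through_vector\<close> and
  \<open>card_T\<close>.\<close>

definition ratio :: real where "ratio = (q ^ N - 1) / (q ^ L - 1)"

definition degree1 :: real where
  "degree1 = (\<Prod>i = 1..<N. (q ^ L - q ^ i) / (q ^ N - q ^ i))"

lemma q_ge_2: "2 \<le> q"
  using order_ge_2 by simp

lemma W_carrier: "W \<subseteq> carrier V"
  using W(1) by (rule subspaceD)

lemma finite_W: "finite W" and finite_T: "finite \<T>"
  using W_carrier by (auto intro: finite_subset_vectors finite_subspaces_in)

lemma subset_span_iff: "C \<in> \<T> \<Longrightarrow> S \<subseteq> carrier V \<Longrightarrow> span S \<subseteq> C \<longleftrightarrow> S \<subseteq> C"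
  using span_subset_subspace[of C S] span_mem[of S] by (auto simp: subspaces_in_def)

lemma card_span_singleton:
  assumes "v \<in> carrier V" "v \<noteq> \<zero>\<^bsub>V\<^esub>"
  shows "card (span {v}) = order K"
  using card_span_insert[of "{}" v] assms by (simp add: span_empty)

lemma card_through_vector:
  assumes v: "v \<in> W" "v \<noteq> \<zero>\<^bsub>V\<^esub>"
  shows "real (card {C \<in> \<T>. v \<in> C}) = degree1"
proof -
  have vV: "{v} \<subseteq> carrier V" using v W_carrier by blast
  have "{C \<in> \<T>. v \<in> C} = {C \<in> \<T>. span {v} \<subseteq> C}"
    using subset_span_iff[OF _ vV] by auto
  also have "real (card \<dots>) = degree1"
    unfolding degree1_def
    by (rule card_subspaces_between[OF W NL(2) span_is_subspace[OF vV]])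
      (use v vV card_span_singleton[of v] span_subset_subspace[OF W(1), of "{v}"] NL(1) in simp_all)
  finally show ?thesis .
qed

text \<open>The counts through the zero space and through a line differ only by the factor with
  index \<open>0\<close>, which is the reciprocal of \<open>ratio\<close>.\<close>

lemma card_T: "real (card \<T>) * ratio = degree1"
proof -
  have Z: "subspace K {\<zero>\<^bsub>V\<^esub>} V" using span_is_subspace[of "{}"] by (simp add: span_empty)
  have "{C \<in> \<T>. {\<zero>\<^bsub>V\<^esub>} \<subseteq> C} = \<T>" using subspaceD(2) by (auto simp: subspaces_in_def)
  then have "real (card \<T>) = (\<Prod>i = 0..<N. (q ^ L - q ^ i) / (q ^ N - q ^ i))"
    using card_subspaces_between[OF W NL(2) Z, of 0] subspaceD(2)[OF W(1)] by simp
  also have "\<dots> = (q ^ L - 1) / (q ^ N - 1) * degree1"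
    unfolding degree1_def using NL by (subst prod.atLeast_Suc_lessThan) auto
  finally have "real (card \<T>) = (q ^ L - 1) / (q ^ N - 1) * degree1" .
  moreover have "1 < q ^ N" "1 < q ^ L" using NL q_ge_2 by (auto intro!: one_less_power)
  ultimately show ?thesis by (simp add: ratio_def)
qed

lemma degree1_pos: "0 < degree1"
  unfolding degree1_def
  using power_order_less NL by (intro prod_pos) (auto intro!: divide_pos_pos)

lemma ratio_pos: "0 < ratio"
proof -
  have "1 < q ^ N" "1 < q ^ L" using NL q_ge_2 by (auto intro!: one_less_power)
  then show ?thesis by (simp add: ratio_def)
qed

lemma card_T_pos: "0 < card \<T>"
  using card_T degree1_pos by (metis card_gt_0_iff finite_T card.empty less_irrefl mult_zero_left of_nat_0)

text \<open>Containing \<open>u\<close> and containing an independent \<open>v\<close> are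
  negatively correlated: given the first, the second has probability
  \<open>(q ^ N - q) / (q ^ L - q)\<close>, which is at most \<open>ratio\<close>.\<close>

lemma card_through_pair:
  assumes u: "u \<in> W" "u \<noteq> \<zero>\<^bsub>V\<^esub>" and v: "v \<in> W" "v \<notin> span {u}"
  shows "real (card {C \<in> \<T>. u \<in> C \<and> v \<in> C}) \<le> degree1 * ratio"
proof (cases "N = 1")
  case True
  \<comment> \<open>A member of \<open>\<T>\<close> is now a line, and the count through a
    two-dimensional space used below would require \<open>2 \<le> N\<close>.\<close>
  have "\<not> (u \<in> C \<and> v \<in> C)" if "C \<in> \<T>" for C
  proof
    assume uv: "u \<in> C \<and> v \<in> C"
    have "{u} \<subseteq> carrier V" "finite C" using u W_carrier finite_W that
      by (auto simp: subspaces_in_def intro: finite_subset)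
    then have "span {u} = C" using uv that u card_span_singleton[of u] subset_span_iff[OF that, of "{u}"] True
      by (intro card_subset_eq) (auto simp: subspaces_in_def)
    then show False using uv v by simp
  qed
  then have none: "{C \<in> \<T>. u \<in> C \<and> v \<in> C} = {}" by auto
  show ?thesis unfolding none using degree1_pos ratio_pos by simp
next
  case False
  then have N2: "2 \<le> N" using NL by simp
  have uvV: "{v, u} \<subseteq> carrier V" using u v W_carrier by blast
  have "{C \<in> \<T>. u \<in> C \<and> v \<in> C} = {C \<in> \<T>. span {v, u} \<subseteq> C}"
    using subset_span_iff[OF _ uvV] by auto
  moreover have "card (span {v, u}) = order K ^ 2"
    using card_span_insert[of "{u}" v] card_span_singleton[of u] u v W_carrier
    by (auto simp: power2_eq_square)
  ultimately have "real (card {C \<in> \<T>. u \<in> C \<and> v \<in> C}) =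
      (\<Prod>i = 2..<N. (q ^ L - q ^ i) / (q ^ N - q ^ i))"
    using card_subspaces_between[OF W NL(2) span_is_subspace[OF uvV], of 2] N2 u v
      span_subset_subspace[OF W(1), of "{v, u}"] by simp
  moreover have "degree1 = (q ^ L - q) / (q ^ N - q) * (\<Prod>i = 2..<N. (q ^ L - q ^ i) / (q ^ N - q ^ i))"
    unfolding degree1_def using N2 by (subst prod.atLeast_Suc_lessThan) (auto simp: numeral_2_eq_2)
  moreover have p: "q < q ^ N" "q < q ^ L" "1 < q ^ L"
    using power_order_less[of 1 N] power_order_less[of 1 L] power_order_less[of 0 L] N2 NL by auto
  ultimately have eq: "real (card {C \<in> \<T>. u \<in> C \<and> v \<in> C}) = degree1 * ((q ^ N - q) / (q ^ L - q))"
    by (simp add: field_simps)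
  \<comment> \<open>The comparison with \<open>ratio\<close>, cross-multiplied; the two sides differ
    by \<open>(q - 1) * (q ^ L - q ^ N)\<close>.\<close>
  have "(q ^ N - q) * (q ^ L - 1) \<le> (q ^ N - 1) * (q ^ L - q)"
  proof -
    have "(q - 1) * q ^ N \<le> (q - 1) * q ^ L"
      using power_order_le[OF NL(2)] q_ge_2 by (intro mult_left_mono) auto
    then show ?thesis by (simp add: algebra_simps)
  qed
  then have "(q ^ N - q) / (q ^ L - q) \<le> ratio"
    unfolding ratio_def using p by (simp add: field_simps)
  then show ?thesis unfolding eq using degree1_pos by (intro mult_left_mono) simp_all
qed

text \<open>If \<open>B\<close> avoids zero and is closed under nonzero scalars, it consists of
  \<open>card B / (q - 1)\<close> punctured lines, and this is the expected number of them in a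
  random member of \<open>\<T>\<close>.\<close>

definition density :: "'c set \<Rightarrow> real" where
  "density B = real (card B) * ratio / (q - 1)"

context
  fixes B
  assumes B_W: "B \<subseteq> W" and B_0: "\<zero>\<^bsub>V\<^esub> \<notin> B"
    and B_smult: "\<And>a v. a \<in> carrier K \<Longrightarrow> a \<noteq> \<zero>\<^bsub>K\<^esub> \<Longrightarrow> v \<in> B \<Longrightarrow> a \<odot>\<^bsub>V\<^esub> v \<in> B"
begin

abbreviation "hit \<equiv> {C \<in> \<T>. C \<inter> B \<noteq> {}}"

lemma finite_B: "finite B" using finite_subset[OF B_W finite_W] .

text \<open>The first moment, by double counting of incidences between vectors and
  subspaces.\<close>

lemma sum_card_Int: "(\<Sum>C\<in>\<T>. real (card (C \<inter> B))) = real (card B) * degree1"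
proof -
  have "(\<Sum>C\<in>\<T>. card (C \<inter> B)) = (\<Sum>C\<in>\<T>. card {v \<in> B. v \<in> C})"
    by (intro sum.cong refl arg_cong[where f = card]) auto
  also have "\<dots> = (\<Sum>v\<in>B. card {C \<in> \<T>. v \<in> C})"
    by (intro sum_multicount_gen finite_T finite_B) simp
  finally have "(\<Sum>C\<in>\<T>. real (card (C \<inter> B))) = (\<Sum>v\<in>B. real (card {C \<in> \<T>. v \<in> C}))"
    by (simp flip: of_nat_sum)
  also have "\<dots> = (\<Sum>v\<in>B. degree1)"
    using B_W B_0 by (intro sum.cong refl card_through_vector) auto
  finally show ?thesis by simp
qed

lemma sum_card_Int_hit: "(\<Sum>C\<in>hit. f (card (C \<inter> B))) = (\<Sum>C\<in>\<T>. f (card (C \<inter> B)))"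
  if "f 0 = (0::real)"
  using that finite_T by (intro sum.mono_neutral_left) auto

text \<open>Markov inequality: a subspace that meets \<open>B\<close> contains a whole punctured
  line of \<open>B\<close>, hence at least \<open>q - 1\<close> vectors of \<open>B\<close>.\<close>

lemma card_hit_le: "real (card hit) \<le> density B * real (card \<T>)"
proof -
  have "q - 1 \<le> real (card (C \<inter> B))" if C: "C \<in> hit" for C
  proof -
    obtain v where v: "v \<in> C" "v \<in> B" using C by blast
    have vV: "v \<in> carrier V" using v B_W W_carrier by blast
    have "v \<noteq> \<zero>\<^bsub>V\<^esub>" using v B_0 by blast
    have sub: "(span {v} - {\<zero>\<^bsub>V\<^esub>}) \<subseteq> C \<inter> B"
    proof
      fix w assume w: "w \<in> span {v} - {\<zero>\<^bsub>V\<^esub>}"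
      then obtain a where a: "a \<in> carrier K" "w = a \<odot>\<^bsub>V\<^esub> v"
        using span_insert_eq[of "{}" v] vV by (auto simp: span_empty)
      then have "a \<noteq> \<zero>\<^bsub>K\<^esub>" using w vV by auto
      then show "w \<in> C \<inter> B" using a v C B_smult subspaceD(4)[of C] by (auto simp: subspaces_in_def)
    qed
    have "finite (span {v})" using vV by (intro finite_subset_vectors span_is_subset2) auto
    then have "card (span {v} - {\<zero>\<^bsub>V\<^esub>}) = order K - 1"
      using card_span_singleton[OF vV \<open>v \<noteq> \<zero>\<^bsub>V\<^esub>\<close>] span_zero by (simp add: card_Diff_singleton)
    then have "order K - 1 \<le> card (C \<inter> B)"
      using card_mono[OF _ sub] finite_B by simp
    then show ?thesis by linarith
  qed
  then have "(\<Sum>C\<in>hit. q - 1) \<le> (\<Sum>C\<in>hit. real (card (C \<inter> B)))" by (rule sum_mono)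
  also have "\<dots> = real (card B) * degree1"
    using sum_card_Int_hit[of real] sum_card_Int by simp
  also have "\<dots> = density B * (q - 1) * real (card \<T>)"
    using q_ge_2 by (simp add: density_def flip: card_T)
  finally have "(q - 1) * real (card hit) \<le> (q - 1) * (density B * real (card \<T>))"
    by (simp add: mult_ac)
  then show ?thesis using q_ge_2 by (simp only: mult_le_cancel_left_pos)
qed

text \<open>The second moment, as a sum over pairs from \<open>B\<close>. At most
  \<open>q - 1\<close> partners of \<open>u\<close> lie on its line, and each of these contributes
  at most \<open>degree1\<close>; all others are covered by
  \<open>card_through_pair\<close>.\<close>

lemma sum_card_Int_squared:
  "(\<Sum>C\<in>\<T>. (real (card (C \<inter> B)))\<^sup>2) \<le> real (card B) * degree1 * ((q - 1) * (1 + density B))"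
proof -
  have "(\<Sum>C\<in>\<T>. (card (C \<inter> B))\<^sup>2) = (\<Sum>C\<in>\<T>. card {p \<in> B \<times> B. fst p \<in> C \<and> snd p \<in> C})"
  proof (rule sum.cong[OF refl])
    fix C
    have "{p \<in> B \<times> B. fst p \<in> C \<and> snd p \<in> C} = (C \<inter> B) \<times> (C \<inter> B)" by auto
    then show "(card (C \<inter> B))\<^sup>2 = card {p \<in> B \<times> B. fst p \<in> C \<and> snd p \<in> C}"
      by (simp add: card_cartesian_product power2_eq_square)
  qed
  also have "\<dots> = (\<Sum>p\<in>B \<times> B. card {C \<in> \<T>. fst p \<in> C \<and> snd p \<in> C})"
    using finite_T finite_B by (intro sum_multicount_gen) auto
  also have "\<dots> = (\<Sum>u\<in>B. \<Sum>v\<in>B. card {C \<in> \<T>. u \<in> C \<and> v \<in> C})"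
    by (simp add: sum.cartesian_product split_def)
  finally have "(\<Sum>C\<in>\<T>. (real (card (C \<inter> B)))\<^sup>2) =
      (\<Sum>u\<in>B. \<Sum>v\<in>B. real (card {C \<in> \<T>. u \<in> C \<and> v \<in> C}))"
    by (simp flip: of_nat_sum of_nat_power)
  also have "\<dots> \<le> (\<Sum>u\<in>B. (q - 1) * degree1 + real (card B) * (degree1 * ratio))"
  proof (rule sum_mono)
    fix u assume u: "u \<in> B"
    then have u': "u \<in> W" "u \<noteq> \<zero>\<^bsub>V\<^esub>" using B_W B_0 by auto
    have uV: "u \<in> carrier V" using u' W_carrier by blast
    let ?g = "\<lambda>v. real (card {C \<in> \<T>. u \<in> C \<and> v \<in> C})"
    have "(\<Sum>v\<in>B. ?g v) = (\<Sum>v\<in>B \<inter> span {u}. ?g v) + (\<Sum>v\<in>B - span {u}. ?g v)"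
      using finite_B by (rule sum.Int_Diff)
    also have "(\<Sum>v\<in>B \<inter> span {u}. ?g v) \<le> (\<Sum>v\<in>B \<inter> span {u}. degree1)"
    proof (rule sum_mono)
      fix v assume "v \<in> B \<inter> span {u}"
      have "?g v \<le> real (card {C \<in> \<T>. u \<in> C})"
        using finite_T by (intro of_nat_mono card_mono) auto
      then show "?g v \<le> degree1" using card_through_vector[OF u'] by simp
    qed
    also have "\<dots> \<le> (q - 1) * degree1"
    proof -
      have "finite (span {u})" using uV by (intro finite_subset_vectors span_is_subset2) auto
      then have "card (B \<inter> span {u}) \<le> card (span {u} - {\<zero>\<^bsub>V\<^esub>})"
        using B_0 by (intro card_mono) auto
      also have "\<dots> = order K - 1"
        using \<open>finite (span {u})\<close> card_span_singleton[OF uV u'(2)] span_zero by (simp add: card_Diff_singleton)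
      finally have "real (card (B \<inter> span {u})) \<le> q - 1" using order_ge_2 by linarith
      then show ?thesis using degree1_pos by simp
    qed
    also have "(\<Sum>v\<in>B - span {u}. ?g v) \<le> (\<Sum>v\<in>B - span {u}. degree1 * ratio)"
      using u' B_W by (intro sum_mono card_through_pair) auto
    also have "\<dots> \<le> real (card B) * (degree1 * ratio)"
      using finite_B degree1_pos ratio_pos by (auto intro!: mult_right_mono card_mono)
    finally show "(\<Sum>v\<in>B. ?g v) \<le> (q - 1) * degree1 + real (card B) * (degree1 * ratio)" by simp
  qed
  also have "\<dots> = real (card B) * (degree1 * ((q - 1) + real (card B) * ratio))"
    by (simp add: algebra_simps)
  also have "real (card B) * ratio = (q - 1) * density B"
    using q_ge_2 by (simp add: density_def)
  also have "real (card B) * (degree1 * ((q - 1) + (q - 1) * density B)) = real (card B) * degree1 * ((q - 1) * (1 + density B))"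
    by (simp only: distrib_left mult_1_right mult.assoc)
  finally show ?thesis .
qed

text \<open>Second moment method. A random member of \<open>\<T>\<close> meets \<open>B\<close> with
  probability at least \<open>density B / (1 + density B)\<close>, written without division.\<close>

lemma card_hit_ge: "density B * real (card \<T>) \<le> (1 + density B) * real (card hit)"
proof -
  define \<kappa> where "\<kappa> = (q - 1) * (1 + density B)"
  define S where "S = real (card B) * degree1"
  let ?c = "\<lambda>C. real (card (C \<inter> B))"
  have dens: "0 \<le> density B" using ratio_pos q_ge_2 by (simp add: density_def)
  then have \<kappa>: "0 < \<kappa>" using q_ge_2 by (simp add: \<kappa>_def)
  have S: "(\<Sum>C\<in>hit. ?c C) = S"
    using sum_card_Int_hit[of real, OF of_nat_0] sum_card_Int by (simp only: S_def)
  have S2: "(\<Sum>C\<in>hit. (?c C)\<^sup>2) \<le> S * \<kappa>"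
    using sum_card_Int_hit[of "\<lambda>x. (real x)\<^sup>2"] sum_card_Int_squared by (simp add: S_def \<kappa>_def)
  \<comment> \<open>Cauchy--Schwarz, linearised at the optimal \<open>\<kappa>\<close>\<close>
  have "(\<Sum>C\<in>hit. 2 * \<kappa> * ?c C) \<le> (\<Sum>C\<in>hit. (?c C)\<^sup>2 + \<kappa>\<^sup>2)"
  proof (rule sum_mono)
    fix C
    have "0 \<le> (?c C - \<kappa>)\<^sup>2" by (rule zero_le_power2)
    then show "2 * \<kappa> * ?c C \<le> (?c C)\<^sup>2 + \<kappa>\<^sup>2"
      by (simp add: power2_diff mult_ac)
  qed
  then have "2 * \<kappa> * S \<le> (\<Sum>C\<in>hit. (?c C)\<^sup>2) + real (card hit) * \<kappa>\<^sup>2"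
    unfolding sum.distrib sum_constant S[symmetric] sum_distrib_left .
  also note S2
  finally have "\<kappa> * S \<le> \<kappa> * (\<kappa> * real (card hit))"
    by (simp add: power2_eq_square algebra_simps)
  then have "S \<le> \<kappa> * real (card hit)" using \<kappa> by (simp only: mult_le_cancel_left_pos)
  moreover have "S = (q - 1) * (density B * real (card \<T>))"
    using q_ge_2 by (simp add: S_def density_def flip: card_T)
  ultimately have "(q - 1) * (density B * real (card \<T>)) \<le> (q - 1) * ((1 + density B) * real (card hit))"
    by (simp only: \<kappa>_def mult.assoc)
  then show ?thesis using q_ge_2 by (simp only: mult_le_cancel_left_pos)
qed

end
end

section \<open>Independent lists along a flag of subspaces\<close>

context finite_vectorspace
begin

text \<open>Linear independence of lists rather than sets, so that a repeated vector counts as a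
  dependence.\<close>

primrec indpt_list :: "'c list \<Rightarrow> bool" where
  "indpt_list [] \<longleftrightarrow> True"
| "indpt_list (v # xs) \<longleftrightarrow> v \<notin> span (set xs) \<and> indpt_list xs"

text \<open>Each further vector multiplies the span by \<open>order K\<close> or leaves it
  unchanged, so the maximal size is reached exactly when no vector is redundant.\<close>

lemma card_span_list:
  assumes "set xs \<subseteq> carrier V"
  shows "card (span (set xs)) \<le> order K ^ length xs \<and>
    (card (span (set xs)) = order K ^ length xs \<longleftrightarrow> indpt_list xs)"
  using assms
proof (induction xs)
  case Nil
  then show ?case by (simp add: span_empty)
next
  case (Cons v xs)
  then have xs: "set xs \<subseteq> carrier V" and v: "v \<in> carrier V" by auto
  note IH = Cons.IH[OF xs]
  show ?case
  proof (cases "v \<in> span (set xs)")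
    case True
    then have "span (set (v # xs)) = span (set xs)"
      using already_in_span[OF xs] by simp
    moreover have "order K ^ length xs < order K ^ length (v # xs)"
      using order_ge_2 by simp
    ultimately show ?thesis using IH True by (auto simp del: power_Suc)
  next
    case False
    then have "card (span (set (v # xs))) = order K * card (span (set xs))"
      using card_span_insert[OF xs v] by simp
    then show ?thesis using IH False order_ge_2 by simp
  qed
qed

text \<open>The list is built from its end, so its entry of index \<open>i\<close> lies in \<open>U (k - 1 - i)\<close>.\<close>

definition flag_lists :: "(nat \<Rightarrow> 'c set) \<Rightarrow> nat \<Rightarrow> 'c list set" where
  "flag_lists U k = {xs. length xs = k \<and> indpt_list xs \<and> (\<forall>i<k. xs ! i \<in> U (k - 1 - i))}"

lemma flag_lists_0: "flag_lists U 0 = {[]}"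
  by (auto simp: flag_lists_def)

text \<open>The new head has index \<open>0\<close> and belongs to \<open>U k\<close>; the older
  entries move up by one index, which compensates the larger \<open>k\<close>.\<close>

lemma flag_lists_Suc:
  "flag_lists U (Suc k) = (\<lambda>(xs, v). v # xs) ` (SIGMA xs:flag_lists U k. U k - span (set xs))"
proof (intro equalityI subsetI)
  fix ws assume ws: "ws \<in> flag_lists U (Suc k)"
  then obtain v xs where "ws = v # xs" by (cases ws) (auto simp: flag_lists_def)
  moreover have "xs ! i \<in> U (k - 1 - i)" if "i < k" for i
    using ws \<open>ws = v # xs\<close> that by (auto simp: flag_lists_def dest!: spec[of _ "Suc i"])
  moreover have "v \<in> U k"
    using ws \<open>ws = v # xs\<close> by (auto simp: flag_lists_def)
  ultimately show "ws \<in> (\<lambda>(xs, v). v # xs) ` (SIGMA xs:flag_lists U k. U k - span (set xs))"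
    using ws by (intro image_eqI[of _ _ "(xs, v)"]) (auto simp: flag_lists_def)
next
  fix ws assume "ws \<in> (\<lambda>(xs, v). v # xs) ` (SIGMA xs:flag_lists U k. U k - span (set xs))"
  then obtain v xs where "ws = v # xs" "xs \<in> flag_lists U k" "v \<in> U k - span (set xs)" by auto
  then show "ws \<in> flag_lists U (Suc k)"
    by (auto simp: flag_lists_def nth_Cons split: nat.split)
qed

text \<open>The \<open>t\<close> vectors chosen first span a space of \<open>order K ^ t\<close>
  elements inside \<open>U t\<close>, and the next vector has to avoid it. Where such a list exists
  this forces \<open>t \<le> c t\<close>, so truncated subtraction does no harm.\<close>

lemma card_flag_lists:
  assumes U: "\<And>t. t < k \<Longrightarrow> subspace K (U t) V" "\<And>t. Suc t < k \<Longrightarrow> U t \<subseteq> U (Suc t)"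
    "\<And>t. t < k \<Longrightarrow> card (U t) = order K ^ c t"
  shows "finite (flag_lists U k)" "card (flag_lists U k) = (\<Prod>t<k. order K ^ c t - order K ^ t)"
proof -
  have mono: "U s \<subseteq> U t" if "s \<le> t" "t < k" for s t
    using that by (induction t rule: dec_induct) (use U(2) in fastforce)+
  have "finite (flag_lists U j) \<and> card (flag_lists U j) = (\<Prod>t<j. order K ^ c t - order K ^ t)"
    if "j \<le> k" for j
    using that
  proof (induction j)
    case 0
    then show ?case by (simp add: flag_lists_0)
  next
    case (Suc j)
    have sub: "subspace K (U j) V" using U(1) Suc.prems by simp
    have UV: "U j \<subseteq> carrier V" using subspaceD(1)[OF sub] .
    have fin: "finite (U j)" using UV by (rule finite_subset_vectors)
    have card1: "card (U j - span (set xs)) = order K ^ c j - order K ^ j" if xs: "xs \<in> flag_lists U j" for xs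
    proof -
      have "set xs \<subseteq> U j"
      proof
        fix v assume "v \<in> set xs"
        then obtain i where "i < j" "v = xs ! i" using xs by (auto simp: in_set_conv_nth flag_lists_def)
        then have "v \<in> U (j - 1 - i)" using xs by (simp add: flag_lists_def)
        then show "v \<in> U j" using mono[of "j - 1 - i" j] Suc.prems by auto
      qed
      then have "span (set xs) \<subseteq> U j" and "set xs \<subseteq> carrier V"
        using span_subset_subspace[OF sub] UV by auto
      moreover have "card (span (set xs)) = order K ^ j"
        using card_span_list[OF \<open>set xs \<subseteq> carrier V\<close>] xs by (simp add: flag_lists_def)
      ultimately show ?thesis
        using U(3)[of j] Suc.prems card_Diff_subset[of "span (set xs)" "U j"] fin finite_subset[OF _ fin]
        by auto
    qed
    have "inj_on (\<lambda>(xs, v). v # xs) (SIGMA xs:flag_lists U j. U j - span (set xs))"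
      by (auto simp: inj_on_def)
    then have "card (flag_lists U (Suc j)) = card (SIGMA xs:flag_lists U j. U j - span (set xs))"
      unfolding flag_lists_Suc by (rule card_image)
    also have "\<dots> = (\<Sum>xs\<in>flag_lists U j. card (U j - span (set xs)))"
      using Suc fin by (intro card_SigmaI) auto
    also have "\<dots> = (\<Sum>xs\<in>flag_lists U j. order K ^ c j - order K ^ j)"
      using card1 by (rule sum.cong[OF refl])
    finally have "card (flag_lists U (Suc j)) = card (flag_lists U j) * (order K ^ c j - order K ^ j)" by simp
    then show ?case using Suc fin by (auto simp: flag_lists_Suc)
  qed
  then show "finite (flag_lists U k)" "card (flag_lists U k) = (\<Prod>t<k. order K ^ c t - order K ^ t)" by auto
qed

end

section \<open>Functions with prescribed support\<close>

lemma (in field) finite_vectorspace_func_space: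
  assumes "finite (carrier R)" "finite S"
  shows "finite_vectorspace R (func_space S)"
proof -
  have "module R (func_space S)" by (rule func_space_is_module)
  then show ?thesis using assms
    by (auto simp: finite_vectorspace_def vectorspace_def finite_vectorspace_axioms_def func_space_def
        intro!: finite_PiE field_axioms)
qed

text \<open>These functions form a dependent product in which only zero is allowed outside
  \<open>A\<close>. The count serves both for whole matrices of shape \<open>F\<close> and for
  single columns.\<close>

lemma (in field) card_supported_functions:
  assumes "finite S" "A \<subseteq> S"
  shows "card {f \<in> carrier (func_space S). \<forall>s\<in>S. f s \<noteq> \<zero> \<longrightarrow> s \<in> A} = order R ^ card A"
proof -
  have "{f \<in> carrier (func_space S). \<forall>s\<in>S. f s \<noteq> \<zero> \<longrightarrow> s \<in> A} =
      (\<Pi>\<^sub>E s\<in>S. if s \<in> A then carrier R else {\<zero>})"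
    by (auto simp: func_space_def PiE_def Pi_def split: if_splits)
  then have "card {f \<in> carrier (func_space S). \<forall>s\<in>S. f s \<noteq> \<zero> \<longrightarrow> s \<in> A} =
      (\<Prod>s\<in>S. if s \<in> A then order R else 1)"
    using assms by (simp add: card_PiE order_def if_distrib cong: if_cong)
  also have "\<dots> = order R ^ card A"
    using assms by (simp add: prod.If_cases Int_absorb1)
  finally show ?thesis .
qed

lemma (in field) subspace_supported_functions:
  assumes "finite (carrier R)" "finite S"
  shows "subspace R {f \<in> carrier (func_space S). \<forall>s\<in>S. f s \<noteq> \<zero> \<longrightarrow> s \<in> A} (func_space S)"
proof -
  interpret V: finite_vectorspace R "func_space S" using assms by (rule finite_vectorspace_func_space)
  show ?thesis
  proof (rule V.subspaceI)
    fix f g assume "f \<in> {f \<in> carrier (func_space S). \<forall>s\<in>S. f s \<noteq> \<zero> \<longrightarrow> s \<in> A}"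
      "g \<in> {f \<in> carrier (func_space S). \<forall>s\<in>S. f s \<noteq> \<zero> \<longrightarrow> s \<in> A}"
    moreover from this have "f \<oplus>\<^bsub>func_space S\<^esub> g \<in> carrier (func_space S)" by simp
    ultimately show "f \<oplus>\<^bsub>func_space S\<^esub> g \<in> {f \<in> carrier (func_space S). \<forall>s\<in>S. f s \<noteq> \<zero> \<longrightarrow> s \<in> A}"
      by (force simp: func_space_def)
  next
    fix a f assume "a \<in> carrier R" "f \<in> {f \<in> carrier (func_space S). \<forall>s\<in>S. f s \<noteq> \<zero> \<longrightarrow> s \<in> A}"
    moreover from this have "a \<odot>\<^bsub>func_space S\<^esub> f \<in> carrier (func_space S)" by simp
    ultimately show "a \<odot>\<^bsub>func_space S\<^esub> f \<in> {f \<in> carrier (func_space S). \<forall>s\<in>S. f s \<noteq> \<zero> \<longrightarrow> s \<in> A}"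
      by (force simp: func_space_def)
  next
    have "\<zero>\<^bsub>func_space S\<^esub> \<in> carrier (func_space S)" by simp
    then show "\<zero>\<^bsub>func_space S\<^esub> \<in> {f \<in> carrier (func_space S). \<forall>s\<in>S. f s \<noteq> \<zero> \<longrightarrow> s \<in> A}"
      by (auto simp: func_space_def)
  qed auto
qed

section \<open>Ferrers diagrams and diagonals\<close>

lemma ferrers_diagramD:
  assumes "ferrers_diagram m n F"
  shows "F \<subseteq> {1..m} \<times> {1..n}"
    and "\<And>i j. (i, j) \<in> F \<Longrightarrow> j < n \<Longrightarrow> (i, Suc j) \<in> F"
    and "\<And>i j. (i, j) \<in> F \<Longrightarrow> 1 < i \<Longrightarrow> (i - 1, j) \<in> F"
  using assms by (auto simp: ferrers_diagram_def)

lemma ferrers_col_subset: "ferrers_diagram m n F \<Longrightarrow> {i. (i, t) \<in> F} \<subseteq> {1..m}"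
  using ferrers_diagramD(1)[of m n F] by auto

lemma ferrers_col_finite: "ferrers_diagram m n F \<Longrightarrow> finite {i. (i, t) \<in> F}"
  using finite_subset[OF ferrers_col_subset] by blast

text \<open>A column is closed under moving up, so it is an initial segment of the rows and its
  largest row equals its size.\<close>

lemma ferrers_mem_iff:
  assumes F: "ferrers_diagram m n F" and t: "t \<in> {1..n}"
  shows "(i, t) \<in> F \<longleftrightarrow> 1 \<le> i \<and> i \<le> col_count F t"
proof -
  let ?S = "{i. (i, t) \<in> F}"
  have sub: "?S \<subseteq> {1..m}" and fin: "finite ?S"
    using ferrers_col_subset[OF F] ferrers_col_finite[OF F] by blast+
  have down: "i \<in> ?S" if "i \<le> k" "1 \<le> i" "k \<in> ?S" for i k
    using that
  proof (induction k arbitrary: i rule: less_induct)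
    case (less k)
    show ?case
    proof (cases "i = k")
      case False
      then have "k > 1" using less.prems by auto
      then have "(k - 1, t) \<in> F" using ferrers_diagramD(3)[OF F] less.prems(3) by simp
      then show ?thesis using less.IH[of "k - 1" i] less.prems False by auto
    qed (use less.prems in simp)
  qed
  have "?S = {1..card ?S}"
  proof (cases "?S = {}")
    case False
    have "?S = {1..Max ?S}"
    proof (intro equalityI subsetI)
      fix i assume "i \<in> {1..Max ?S}"
      then show "i \<in> ?S" using down[of i "Max ?S"] Max_in[OF fin False] by auto
    qed (use sub fin in auto)
    then show ?thesis by (metis card_atLeastAtMost diff_Suc_1)
  qed simp
  then have "i \<in> ?S \<longleftrightarrow> i \<in> {1..card ?S}" by (rule arg_cong)
  then show ?thesis by (simp add: col_count_def)
qed

lemma ferrers_col_mono: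
  assumes F: "ferrers_diagram m n F" and "1 \<le> s" "s \<le> t" "t \<le> n"
  shows "col_count F s \<le> col_count F t"
  using assms(3,4)
proof (induction t rule: dec_induct)
  case (step k)
  have "{i. (i, k) \<in> F} \<subseteq> {i. (i, Suc k) \<in> F}"
    using ferrers_diagramD(2)[OF F, of _ k] step.prems by (simp add: Collect_mono)
  then have "col_count F k \<le> col_count F (Suc k)"
    unfolding col_count_def by (rule card_mono[OF ferrers_col_finite[OF F]])
  then show ?case using step by simp
qed simp

lemma ferrers_col_le:
  assumes "ferrers_diagram m n F"
  shows "col_count F t \<le> m"
proof -
  have "card {i. (i, t) \<in> F} \<le> card {1..m}"
    by (rule card_mono[OF _ ferrers_col_subset[OF assms]]) simp
  then show ?thesis by (simp add: col_count_def)
qed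

lemma ferrers_card:
  assumes F: "ferrers_diagram m n F"
  shows "card F = (\<Sum>t = 1..n. col_count F t)"
proof -
  have "F = (\<lambda>(t, i). (i, t)) ` (SIGMA t:{1..n}. {i. (i, t) \<in> F})"
    using F by (force simp: ferrers_diagram_def)
  also have "card \<dots> = card (SIGMA t:{1..n}. {i. (i, t) \<in> F})"
    by (rule card_image) (auto simp: inj_on_def)
  also have "\<dots> = (\<Sum>t = 1..n. card {i. (i, t) \<in> F})"
    by (rule card_SigmaI) (simp_all add: ferrers_col_finite[OF F])
  finally show ?thesis by (simp add: col_count_def)
qed

text \<open>The number \<open>h\<close> of the overview. By truncation it is \<open>0\<close> as
  soon as \<open>col_count F (Suc j) \<le> j\<close> for one \<open>j\<close> in the range.\<close>

definition staircase_height :: "nat \<Rightarrow> (nat \<times> nat) set \<Rightarrow> nat" where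
  "staircase_height n F = Min ((\<lambda>j. col_count F (Suc j) - j) ` {0..n - 1})"

lemma staircase_height_le: "j \<le> n - 1 \<Longrightarrow> staircase_height n F \<le> col_count F (Suc j) - j"
  by (simp add: staircase_height_def)

lemma staircase_height_attained: "\<exists>j\<le>n - 1. staircase_height n F = col_count F (Suc j) - j"
proof -
  have "staircase_height n F \<in> (\<lambda>j. col_count F (Suc j) - j) ` {0..n - 1}"
    unfolding staircase_height_def by (intro Min_in) auto
  then show ?thesis by auto
qed

lemma le_staircase_height_iff:
  "s \<le> staircase_height n F \<longleftrightarrow> (\<forall>j\<le>n - 1. s \<le> col_count F (Suc j) - j)"
  unfolding staircase_height_def by (subst Min_ge_iff) auto

section \<open>The values \<open>nu\<close> and the complete diagonals\<close>

lemma nu_min_le: "j \<le> n - 1 \<Longrightarrow> nu_min n F n \<le> nu n F n j"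
  by (simp add: nu_min_def)

lemma nu_min_attained: "\<exists>j\<le>n - 1. nu_min n F n = nu n F n j"
proof -
  have "nu_min n F n \<in> nu n F n ` {0..n - 1}" unfolding nu_min_def by (intro Min_in) auto
  then show ?thesis by auto
qed

lemma nu_eq: "nu n F n j = (\<Sum>t = 1..Suc j. col_count F t - j)"
  by (simp add: nu_def)

lemma nu_0: "nu n F n 0 = col_count F 1"
  by (simp add: nu_eq)

text \<open>The last summand of \<open>nu n F n j\<close> alone is already at least the staircase
  height.\<close>

lemma staircase_height_le_nu_min: "staircase_height n F \<le> nu_min n F n"
proof -
  obtain j where j: "j \<le> n - 1" "nu_min n F n = nu n F n j" using nu_min_attained by blast
  have "col_count F (Suc j) - j \<le> nu n F n j"
    unfolding nu_eq by (rule member_le_sum) auto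
  then show ?thesis using staircase_height_le[OF j(1), of F] j(2) by linarith
qed

text \<open>If \<open>col_count F (Suc j) \<le> j\<close>, monotonicity of the columns makes every
  summand of \<open>nu n F n j\<close> vanish.\<close>

lemma staircase_height_pos:
  assumes F: "ferrers_diagram m n F" and n: "1 \<le> n" and "0 < nu_min n F n"
  shows "0 < staircase_height n F"
proof (rule ccontr)
  assume "\<not> 0 < staircase_height n F"
  then obtain j where j: "j \<le> n - 1" "col_count F (Suc j) \<le> j"
    using staircase_height_attained[of n F] by auto
  have "col_count F t - j = 0" if "t \<in> {1..Suc j}" for t
  proof -
    have "1 \<le> t" "t \<le> Suc j" "Suc j \<le> n" using that j(1) n by auto
    then show ?thesis using ferrers_col_mono[OF F, of t "Suc j"] j(2) by linarith
  qed
  then have "nu n F n j = 0" unfolding nu_eq by simp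
  then show False using nu_min_le[OF j(1), of F] assms by simp
qed

text \<open>A diagonal has at most one cell per column, so each summand is \<open>1\<close> or
  \<open>0\<close>, according to whether the diagonal has all \<open>n\<close> cells in
  \<open>F\<close>. As diagonal \<open>i\<close> meets column \<open>t\<close> in row
  \<open>i + t - n\<close>, this happens exactly for \<open>n \<le> i < n + h\<close>, with
  \<open>h\<close> the staircase height.\<close>

lemma sum_diagonals:
  assumes F: "ferrers_diagram m n F" and n: "1 \<le> n"
  shows "(\<Sum>i = 1..m. card (diagonal m n i \<inter> F) + 1 - n) = staircase_height n F"
proof -
  let ?h = "staircase_height n F"
  have summand: "card (diagonal m n i \<inter> F) + 1 - n = (if n \<le> i \<and> i < n + ?h then 1 else 0)" if i: "i \<in> {1..m}" for i
  proof -
    let ?D = "diagonal m n i \<inter> F"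
    have inj: "inj_on snd ?D" by (auto simp: inj_on_def diagonal_def)
    have sub: "snd ` ?D \<subseteq> {1..n}" by (auto simp: diagonal_def)
    have card: "card ?D = card (snd ` ?D)" by (rule card_image[OF inj, symmetric])
    have le: "card ?D \<le> n" using card_mono[OF _ sub] card by simp
    have "card ?D = n \<longleftrightarrow> snd ` ?D = {1..n}"
      unfolding card using card_subset_eq[OF _ sub] by (metis card_atLeastAtMost diff_Suc_1 finite_atLeastAtMost)
    also have "\<dots> \<longleftrightarrow> (\<forall>t\<in>{1..n}. n < i + t \<and> (i + t - n, t) \<in> F)"
    proof
      assume eq: "snd ` ?D = {1..n}"
      show "\<forall>t\<in>{1..n}. n < i + t \<and> (i + t - n, t) \<in> F"
      proof
        fix t assume "t \<in> {1..n}"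
        then have "t \<in> snd ` ?D" using eq by simp
        then obtain k where "(k, t) \<in> ?D" by (metis imageE prod.collapse)
        then have k: "1 \<le> k" "int t - int k = int n - int i" "(k, t) \<in> F" by (auto simp: diagonal_def)
        then have kt: "k = i + t - n" "n < i + t" by linarith+
        show "n < i + t \<and> (i + t - n, t) \<in> F"
          using kt k(3) by simp
      qed
    next
      assume all: "\<forall>t\<in>{1..n}. n < i + t \<and> (i + t - n, t) \<in> F"
      have "{1..n} \<subseteq> snd ` ?D"
      proof
        fix t assume "t \<in> {1..n}"
        then have t: "n < i + t" "(i + t - n, t) \<in> F" using all by auto
        then have "(i + t - n, t) \<in> ?D"
          using ferrers_diagramD(1)[OF F] by (auto simp: diagonal_def)
        then show "t \<in> snd ` ?D" by (rule rev_image_eqI) simp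
      qed
      then show "snd ` ?D = {1..n}" using sub by blast
    qed
    also have "\<dots> \<longleftrightarrow> n \<le> i \<and> i < n + ?h"
    proof
      assume all: "\<forall>t\<in>{1..n}. n < i + t \<and> (i + t - n, t) \<in> F"
      \<comment> \<open>Column \<open>1\<close> already forces the diagonal to start in row
        \<open>1\<close> or below.\<close>
      then have "n < i + 1" using n by (auto dest!: bspec[of _ _ 1])
      then have "n \<le> i" by simp
      moreover have "i + 1 - n \<le> ?h"
        unfolding le_staircase_height_iff
      proof (intro allI impI)
        fix j assume "j \<le> n - 1"
        then have "Suc j \<in> {1..n}" using n by auto
        then have "i + Suc j - n \<le> col_count F (Suc j)" using all ferrers_mem_iff[OF F] by blast
        then show "i + 1 - n \<le> col_count F (Suc j) - j" using \<open>n \<le> i\<close> by linarith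
      qed
      ultimately show "n \<le> i \<and> i < n + ?h" by linarith
    next
      assume i': "n \<le> i \<and> i < n + ?h"
      show "\<forall>t\<in>{1..n}. n < i + t \<and> (i + t - n, t) \<in> F"
      proof
        fix t assume t: "t \<in> {1..n}"
        then have "?h \<le> col_count F t - (t - 1)" using staircase_height_le[of "t - 1" n F] by auto
        then have "i + t - n \<le> col_count F t" using i' t by auto
        moreover have "n < i + t" using i' t by auto
        ultimately show "n < i + t \<and> (i + t - n, t) \<in> F"
          using ferrers_mem_iff[OF F t, of "i + t - n"] by simp
      qed
    qed
    finally have iff: "card ?D = n \<longleftrightarrow> n \<le> i \<and> i < n + ?h" .
    show ?thesis
    proof (cases "card ?D = n")
      case True
      then show ?thesis using iff by simp
    next
      case False
      then have "card ?D + 1 - n = 0" using le by simp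
      then show ?thesis using iff False by simp
    qed
  qed
  \<comment> \<open>All counted indices stay within \<open>{1..m}\<close>. For height
    \<open>0\<close> the index interval is empty and no bound is available, since
    \<open>n \<le> m\<close> is not assumed here.\<close>
  have h: "n + ?h \<le> Suc m" if "?h \<noteq> 0"
  proof -
    have "?h \<le> col_count F n - (n - 1)" using staircase_height_le[of "n - 1" n F] n by simp
    then show ?thesis using ferrers_col_le[OF F, of n] that n by linarith
  qed
  have "(\<Sum>i = 1..m. card (diagonal m n i \<inter> F) + 1 - n) = (\<Sum>i = 1..m. if n \<le> i \<and> i < n + ?h then 1 else 0)"
    using summand by (rule sum.cong[OF refl])
  also have "\<dots> = card {i \<in> {1..m}. n \<le> i \<and> i < n + ?h}" by (simp add: sum.If_cases Int_def)
  also have "{i \<in> {1..m}. n \<le> i \<and> i < n + ?h} = {n..<n + ?h}"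
    using h n by (cases "?h = 0") auto
  finally show ?thesis by simp
qed

lemma mds_constructible_iff:
  assumes "ferrers_diagram m n F" "1 \<le> n"
  shows "mds_constructible m n F n \<longleftrightarrow> nu_min n F n = staircase_height n F"
  unfolding mds_constructible_def sum_diagonals[OF assms] ..

text \<open>With \<open>h\<close> the staircase height, the last two summands of
  \<open>nu n F n j\<close> are at least \<open>h - 1\<close> and \<open>h\<close>, and
  \<open>2 * h - 1\<close> exceeds \<open>h\<close> because \<open>1 < h\<close>.\<close>

lemma nu_gt_staircase_height:
  assumes n: "1 \<le> n" and h: "1 < staircase_height n F" and j: "j \<in> {1..n - 1}"
  shows "staircase_height n F < nu n F n j"
proof -
  have "staircase_height n F \<le> col_count F (Suc j) - j"
    and "staircase_height n F \<le> col_count F j - (j - 1)"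
    using staircase_height_le[of j n F] staircase_height_le[of "j - 1" n F] j by auto
  moreover have "(col_count F j - j) + (col_count F (Suc j) - j) \<le> nu n F n j"
  proof -
    have "(col_count F j - j) + (col_count F (Suc j) - j) = (\<Sum>t\<in>{j, Suc j}. col_count F t - j)"
      by simp
    also have "\<dots> \<le> nu n F n j"
      unfolding nu_eq using j by (intro sum_mono2) auto
    finally show ?thesis .
  qed
  ultimately show ?thesis using h by linarith
qed

text \<open>Constructibility makes the minimum equal to the staircase height, which every
  \<open>nu\<close> of positive index exceeds; so the minimum is attained at index
  \<open>0\<close>.\<close>

lemma mds_constructible_nu:
  assumes F: "ferrers_diagram m n F" and n: "1 \<le> n"
    and mds: "mds_constructible m n F n" and pos: "0 < nu_min n F n" and "nu_min n F n \<noteq> 1"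
  shows "nu_min n F n = nu n F n 0" and "\<And>j. j \<in> {1..n - 1} \<Longrightarrow> col_count F 1 < nu n F n j"
proof -
  have eq: "nu_min n F n = staircase_height n F" using mds mds_constructible_iff[OF F n] by simp
  have gt: "nu_min n F n < nu n F n j" if "j \<in> {1..n - 1}" for j
    using nu_gt_staircase_height[OF n _ that, of F] eq assms by simp
  obtain j where j: "j \<le> n - 1" "nu_min n F n = nu n F n j" using nu_min_attained by blast
  then have "j = 0" using gt[of j] by (cases "j = 0") auto
  then show "nu_min n F n = nu n F n 0" using j by simp
  then show "col_count F 1 < nu n F n j" if "j \<in> {1..n - 1}" for j
    using gt[OF that] nu_0[of n F] by simp
qed

lemma ferrers_full: "ferrers_diagram m n ({1..m} \<times> {1..n})"
  by (auto simp: ferrers_diagram_def)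

text \<open>The last column bounds the height by \<open>m - (n - 1)\<close>, whereas index
  \<open>j\<close> gives \<open>(j + 1) * (m - j)\<close>, which is strictly larger for every
  \<open>j \<le> n - 1\<close> because \<open>1 < n\<close>.\<close>

lemma full_not_mds_constructible:
  assumes "1 < n" "n \<le> m"
  shows "\<not> mds_constructible m n ({1..m} \<times> {1..n}) n"
proof -
  let ?F = "{1..m} \<times> {1..n}"
  have col: "col_count ?F t = m" if "t \<in> {1..n}" for t
  proof -
    have "{i. (i, t) \<in> ?F} = {1..m}" using that by auto
    then show ?thesis by (simp add: col_count_def)
  qed
  have h: "staircase_height n ?F \<le> m - (n - 1)"
    using staircase_height_le[of "n - 1" n ?F] col[of n] assms by simp
  have "staircase_height n ?F < nu n ?F n j" if "j \<le> n - 1" for j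
  proof (cases "j = 0")
    case True
    then show ?thesis using h nu_0[of n ?F] col[of 1] assms by simp
  next
    case False
    have "nu n ?F n j = (\<Sum>t = 1..Suc j. m - j)"
      unfolding nu_eq by (intro sum.cong refl) (use that assms col in auto)
    then have "nu n ?F n j = (m - j) + j * (m - j)" by simp
    moreover have "0 < j * (m - j)" using False that assms by simp
    ultimately show ?thesis using h that by linarith
  qed
  then have "staircase_height n ?F < nu_min n ?F n" using nu_min_attained[of n ?F] by auto
  then show ?thesis using mds_constructible_iff[OF ferrers_full, of n m] assms by simp
qed

section \<open>Matrices of a given shape\<close>

locale ferrers_codes = field K for K (structure) +
  fixes m n :: nat and F :: "(nat \<times> nat) set"
  assumes finite_K: "finite (carrier K)" and n_pos: "1 \<le> n" and ferrers: "ferrers_diagram m n F"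

definition (in ferrers_codes) column_space :: "('a, nat \<Rightarrow> 'a) module" where
  "column_space = func_space {1..m}"

sublocale ferrers_codes \<subseteq> mat: finite_vectorspace K "mat_space K m n"
  unfolding mat_space_def by (rule finite_vectorspace_func_space) (simp_all add: finite_K)

sublocale ferrers_codes \<subseteq> col: finite_vectorspace K column_space
  unfolding column_space_def by (rule finite_vectorspace_func_space) (simp_all add: finite_K)

context ferrers_codes
begin

abbreviation "shapes \<equiv> shape_space K m n F"

text \<open>The columns in reverse order, so that every entry is followed by the columns to its left.\<close>

definition cols :: "(nat \<times> nat \<Rightarrow> 'a) \<Rightarrow> (nat \<Rightarrow> 'a) list" where
  "cols A = map (column m A) (rev [1..<Suc n])"

text \<open>The admissible columns with number \<open>t + 1\<close>. These spaces grow with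
  \<open>t\<close> because \<open>F\<close> is closed to the right, so \<open>flag_lists\<close>
  applies to them.\<close>

definition flag :: "nat \<Rightarrow> (nat \<Rightarrow> 'a) set" where
  "flag t = {f \<in> carrier (column_space). \<forall>i\<in>{1..m}. f i \<noteq> \<zero> \<longrightarrow> i \<in> {i. (i, Suc t) \<in> F}}"

lemma shape_space_eq:
  "shapes = {f \<in> carrier (func_space ({1..m} \<times> {1..n})). \<forall>p\<in>{1..m} \<times> {1..n}. f p \<noteq> \<zero> \<longrightarrow> p \<in> F}"
  by (simp add: shape_space_def mat_space_def)

lemma subspace_shapes: "subspace K shapes (mat_space K m n)"
  unfolding shape_space_eq mat_space_def by (rule subspace_supported_functions) (simp_all add: finite_K)

lemma card_shapes: "card shapes = order K ^ card F"
  unfolding shape_space_eq using ferrers_diagramD(1)[OF ferrers]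
  by (intro card_supported_functions) auto

lemma subspace_flag: "subspace K (flag t) (column_space)"
  unfolding flag_def column_space_def by (rule subspace_supported_functions) (simp_all add: finite_K)

lemma card_flag: "card (flag t) = order K ^ col_count F (Suc t)"
  unfolding flag_def col_count_def column_space_def
  using ferrers_col_subset[OF ferrers] by (intro card_supported_functions) auto

lemma flag_mono: "Suc t < n \<Longrightarrow> flag t \<subseteq> flag (Suc t)"
  using ferrers_diagramD(2)[OF ferrers, of _ "Suc t"] by (auto simp: flag_def)

lemma carrier_col: "carrier (column_space) = {1..m} \<rightarrow>\<^sub>E carrier K"
  by (simp add: column_space_def func_space_def)

lemma carrier_mat: "carrier (mat_space K m n) = {1..m} \<times> {1..n} \<rightarrow>\<^sub>E carrier K"
  by (simp add: mat_space_def func_space_def)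

lemma column_carrier:
  assumes "A \<in> carrier (mat_space K m n)" "j \<in> {1..n}"
  shows "column m A j \<in> carrier (column_space)"
  using assms by (auto simp: carrier_mat carrier_col column_def)

lemma length_cols [simp]: "length (cols A) = n"
  by (simp add: cols_def)

lemma cols_nth: "i < n \<Longrightarrow> cols A ! i = column m A (n - i)"
  by (simp add: cols_def rev_nth Suc_diff_Suc del: upt_Suc)

lemma set_cols: "set (cols A) = column m A ` {1..n}"
  by (simp add: cols_def atLeastLessThanSuc_atLeastAtMost del: upt_Suc)

lemma set_cols_carrier:
  "A \<in> carrier (mat_space K m n) \<Longrightarrow> set (cols A) \<subseteq> carrier (column_space)"
  using column_carrier by (auto simp: set_cols)

lemma inj_cols: "inj_on cols (carrier (mat_space K m n))"
proof (rule inj_onI)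
  fix A B assume AB: "A \<in> carrier (mat_space K m n)" "B \<in> carrier (mat_space K m n)" "cols A = cols B"
  show "A = B"
  proof (rule PiE_ext)
    show "A \<in> {1..m} \<times> {1..n} \<rightarrow>\<^sub>E carrier K" "B \<in> {1..m} \<times> {1..n} \<rightarrow>\<^sub>E carrier K"
      using AB by (simp_all add: carrier_mat)
    fix p assume "p \<in> {1..m} \<times> {1..n}"
    then obtain i j where p: "p = (i, j)" "i \<in> {1..m}" "j \<in> {1..n}" by blast
    have "cols A ! (n - j) = cols B ! (n - j)" using AB(3) by simp
    then have "column m A j = column m B j" using p(3) n_pos by (simp add: cols_nth)
    then have "column m A j i = column m B j i" by simp
    then show "A p = B p" using p by (simp add: column_def)
  qed
qed

text \<open>\<open>cols\<close> is a bijection onto \<open>col.flag_lists flag n\<close>: entry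
  \<open>i\<close> of the list is column \<open>n - i\<close>, which belongs to
  \<open>flag (n - 1 - i)\<close>.\<close>

lemma card_full_rank:
  "card {A \<in> shapes. col.indpt_list (cols A)} = (\<Prod>t<n. order K ^ col_count F (Suc t) - order K ^ t)"
proof -
  let ?A = "{A \<in> shapes. col.indpt_list (cols A)}"
  have "cols ` ?A = col.flag_lists flag n"
  proof (intro equalityI subsetI)
    fix xs assume "xs \<in> cols ` ?A"
    then obtain A where A: "A \<in> shapes" "col.indpt_list (cols A)" "xs = cols A" by blast
    have AV: "A \<in> carrier (mat_space K m n)" using A(1) by (simp add: shape_space_def)
    have "cols A ! i \<in> flag (n - 1 - i)" if "i < n" for i
    proof -
      have j: "Suc (n - 1 - i) = n - i" "n - i \<in> {1..n}" using that by auto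
      have "column m A (n - i) k \<noteq> \<zero> \<longrightarrow> (k, n - i) \<in> F" if "k \<in> {1..m}" for k
        using A(1) that j by (auto simp: shape_space_def column_def)
      then show ?thesis
        unfolding flag_def j(1) cols_nth[OF that] using column_carrier[OF AV j(2)] by simp
    qed
    then show "xs \<in> col.flag_lists flag n" using A by (simp add: col.flag_lists_def)
  next
    fix xs assume xs: "xs \<in> col.flag_lists flag n"
    then have len: "length xs = n" and ind: "col.indpt_list xs" and
      fl: "\<And>i. i < n \<Longrightarrow> xs ! i \<in> flag (n - 1 - i)" by (auto simp: col.flag_lists_def)
    \<comment> \<open>The inverse of \<open>cols\<close>: list entry \<open>n - j\<close> becomes
      column \<open>j\<close>.\<close>
    define A where "A = (\<lambda>(i, j)\<in>{1..m} \<times> {1..n}. (xs ! (n - j)) i)"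
    have fl': "xs ! (n - j) \<in> flag (j - 1)" if "j \<in> {1..n}" for j
    proof -
      have "n - 1 - (n - j) = j - 1" "n - j < n" using that by auto
      then show ?thesis using fl[of "n - j"] by simp
    qed
    have entry: "A (i, j) \<in> carrier K" "A (i, j) \<noteq> \<zero> \<longrightarrow> (i, j) \<in> F" if "i \<in> {1..m}" "j \<in> {1..n}" for i j
      using fl'[OF that(2)] that by (auto simp: A_def flag_def carrier_col)
    have "A \<in> carrier (mat_space K m n)"
      unfolding carrier_mat using entry(1) by (intro PiE_I) (auto simp: A_def)
    then have "A \<in> shapes" using entry(2) by (auto simp: shape_space_def)
    moreover have "cols A = xs"
    proof (rule nth_equalityI)
      fix i assume "i < length (cols A)"
      then have i: "i < n" "n - i \<in> {1..n}" "n - (n - i) = i" by auto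
      have "xs ! i \<in> {1..m} \<rightarrow>\<^sub>E carrier K" using fl[OF i(1)] by (simp add: flag_def carrier_col)
      then have "column m A (n - i) = xs ! i"
        using i by (auto simp: column_def A_def PiE_def extensional_def fun_eq_iff restrict_def)
      then show "cols A ! i = xs ! i" using i by (simp add: cols_nth)
    qed (simp add: len)
    ultimately show "xs \<in> cols ` ?A" using ind by blast
  qed
  moreover have "inj_on cols ?A"
    using inj_cols by (rule inj_on_subset) (auto simp: shape_space_def)
  ultimately have "card ?A = card (col.flag_lists flag n)" using card_image by fastforce
  then show ?thesis
    using col.card_flag_lists(2)[of n flag "\<lambda>t. col_count F (Suc t)"] subspace_flag flag_mono card_flag by simp
qed

section \<open>Rank, deficient matrices and maximal codes\<close>

lemma card_span_columns:
  assumes "A \<in> carrier (mat_space K m n)"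
  shows "card (col.span (set (cols A))) = order K ^ mat_rank K m n A"
proof -
  have "subspace_dim K column_space (col.span (set (cols A))) = mat_rank K m n A"
    by (simp only: mat_rank_def set_cols column_space_def Let_def)
  then show ?thesis
    using col.subspace_dim_eq_iff[OF col.span_is_subspace[OF set_cols_carrier[OF assms]]] by blast
qed

lemma mat_rank_le:
  assumes "A \<in> carrier (mat_space K m n)"
  shows "mat_rank K m n A \<le> n"
proof (rule ccontr)
  assume "\<not> mat_rank K m n A \<le> n"
  then have "order K ^ n < order K ^ mat_rank K m n A" using col.order_ge_2 by simp
  then show False using col.card_span_list[OF set_cols_carrier[OF assms]] card_span_columns[OF assms] by simp
qed

lemma mat_rank_eq_iff:
  assumes "A \<in> carrier (mat_space K m n)"
  shows "mat_rank K m n A = n \<longleftrightarrow> col.indpt_list (cols A)"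
  using col.card_span_list[OF set_cols_carrier[OF assms]] card_span_columns[OF assms] col.order_ge_2 by simp

text \<open>The columns of the multiple lie in the column span of \<open>A\<close>. This is what
  keeps \<open>deficient\<close> closed under nonzero scalars.\<close>

lemma mat_rank_smult_le:
  assumes A: "A \<in> carrier (mat_space K m n)" and a: "a \<in> carrier K"
  shows "mat_rank K m n (a \<odot>\<^bsub>mat_space K m n\<^esub> A) \<le> mat_rank K m n A"
proof -
  let ?B = "a \<odot>\<^bsub>mat_space K m n\<^esub> A"
  have B: "?B \<in> carrier (mat_space K m n)" using assms by simp
  have sub: "subspace K (col.span (set (cols A))) (column_space)"
    by (rule col.span_is_subspace[OF set_cols_carrier[OF A]])
  have "column m ?B j = a \<odot>\<^bsub>column_space\<^esub> column m A j" if "j \<in> {1..n}" for j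
    using that by (auto simp: column_def mat_space_def column_space_def func_space_def)
  then have "set (cols ?B) \<subseteq> col.span (set (cols A))"
    using col.span_mem[OF set_cols_carrier[OF A]] col.subspaceD(4)[OF sub a] by (auto simp: set_cols)
  then have "col.span (set (cols ?B)) \<subseteq> col.span (set (cols A))"
    by (rule col.span_subset_subspace[OF sub])
  moreover have "finite (col.span (set (cols A)))"
    using col.subspaceD(1)[OF sub] by (rule col.finite_subset_vectors)
  ultimately have "order K ^ mat_rank K m n ?B \<le> order K ^ mat_rank K m n A"
    using card_mono card_span_columns[OF A] card_span_columns[OF B] by metis
  then show ?thesis using col.order_ge_2 by simp
qed

text \<open>The bad set for the moment bounds. The zero matrix is left out because it lies in every
  subspace.\<close>

definition deficient :: "(nat \<times> nat \<Rightarrow> 'a) set" where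
  "deficient = {A \<in> shapes - {\<zero>\<^bsub>mat_space K m n\<^esub>}. mat_rank K m n A \<noteq> n}"

lemma deficient_smult:
  assumes a: "a \<in> carrier K" "a \<noteq> \<zero>" and A: "A \<in> deficient"
  shows "a \<odot>\<^bsub>mat_space K m n\<^esub> A \<in> deficient"
proof -
  have AV: "A \<in> carrier (mat_space K m n)" using A by (simp add: deficient_def shape_space_def)
  have "mat_rank K m n (a \<odot>\<^bsub>mat_space K m n\<^esub> A) < n"
    using mat_rank_smult_le[OF AV a(1)] mat_rank_le[OF AV] A by (simp add: deficient_def)
  moreover have "a \<odot>\<^bsub>mat_space K m n\<^esub> A \<in> shapes"
    using mat.subspaceD(4)[OF subspace_shapes a(1)] A by (simp add: deficient_def)
  moreover have "a \<odot>\<^bsub>mat_space K m n\<^esub> A \<noteq> \<zero>\<^bsub>mat_space K m n\<^esub>"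
  proof
    assume "a \<odot>\<^bsub>mat_space K m n\<^esub> A = \<zero>\<^bsub>mat_space K m n\<^esub>"
    then have "A = inv a \<odot>\<^bsub>mat_space K m n\<^esub> \<zero>\<^bsub>mat_space K m n\<^esub>"
      using mat.mult_inverse[OF a(1) AV _ a(2)] by blast
    then show False using A a by (simp add: deficient_def field_Units)
  qed
  ultimately show ?thesis by (simp add: deficient_def)
qed

text \<open>The matrices of the shape split into deficient ones, zero and those of rank
  \<open>n\<close>. The additive form avoids truncated subtraction.\<close>

lemma card_deficient:
  "card deficient + 1 + (\<Prod>t<n. order K ^ col_count F (Suc t) - order K ^ t) = order K ^ card F"
proof -
  let ?full = "{A \<in> shapes. col.indpt_list (cols A)}"
  let ?z = "\<zero>\<^bsub>mat_space K m n\<^esub>"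
  have z: "?z \<in> shapes" by (rule mat.subspaceD(2)[OF subspace_shapes])
  have fin: "finite shapes"
    using mat.finite_subset_vectors[OF mat.subspaceD(1)[OF subspace_shapes]] .
  \<comment> \<open>Since \<open>1 \<le> n\<close>, the zero matrix has a zero column, and an
    independent list never contains the zero vector.\<close>
  have "cols ?z ! (n - 1) = \<zero>\<^bsub>column_space\<^esub>"
    using n_pos by (auto simp: cols_nth column_def mat_space_def column_space_def func_space_def)
  then have "\<zero>\<^bsub>column_space\<^esub> \<in> set (cols ?z)" using n_pos nth_mem[of "n - 1" "cols ?z"] by simp
  moreover have "col.indpt_list xs \<Longrightarrow> \<zero>\<^bsub>column_space\<^esub> \<notin> set xs" for xs
    by (induction xs) (use col.span_zero in auto)
  ultimately have z_def: "?z \<notin> ?full" by blast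
  have "shapes = (deficient \<union> {?z}) \<union> ?full"
    using z mat_rank_eq_iff by (auto simp: deficient_def shape_space_def)
  moreover have "(deficient \<union> {?z}) \<inter> ?full = {}"
    using z_def mat_rank_eq_iff by (auto simp: deficient_def shape_space_def)
  moreover have fin': "finite deficient" "finite ?full" using fin by (auto simp: deficient_def)
  ultimately have "card shapes = card (deficient \<union> {?z}) + card ?full"
    using card_Un_disjoint[of "deficient \<union> {?z}" ?full] by simp
  also have "card (deficient \<union> {?z}) = card deficient + 1"
    using card_Un_disjoint[of deficient "{?z}"] fin' by (simp add: deficient_def)
  finally have "card shapes = card deficient + 1 + card ?full" .
  then show ?thesis using card_shapes card_full_rank by simp
qed

lemma shape_subspaces_eq:
  "shape_subspaces K m n F n = mat.subspaces_in shapes (nu_min n F n)"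
  using mat.subspace_dim_eq_iff by (auto simp: shape_subspaces_def mat.subspaces_in_def)

text \<open>Positivity of \<open>nu_min\<close> makes the code nonzero, so
  \<open>rank_distance\<close> is a minimum over a nonempty finite set of ranks, all at most
  \<open>n\<close>. It equals \<open>n\<close> exactly when every rank does.\<close>

lemma maximal_codes_eq:
  assumes "0 < nu_min n F n"
  shows "maximal_codes K m n F n = {C \<in> shape_subspaces K m n F n. C \<inter> deficient = {}}"
proof -
  let ?z = "\<zero>\<^bsub>mat_space K m n\<^esub>"
  have "(C \<noteq> {?z} \<longrightarrow> rank_distance K m n C = n) \<longleftrightarrow> C \<inter> deficient = {}"
    if C: "C \<in> shape_subspaces K m n F n" for C
  proof -
    have sub: "subspace K C (mat_space K m n)" "C \<subseteq> shapes" "card C = order K ^ nu_min n F n"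
      using C by (auto simp: shape_subspaces_eq mat.subspaces_in_def)
    have CV: "C \<subseteq> carrier (mat_space K m n)" using mat.subspaceD(1)[OF sub(1)] .
    have "1 < card C" unfolding sub(3) using assms mat.order_ge_2 by (intro one_less_power) auto
    then have "\<not> C \<subseteq> {?z}" using card_mono[of "{?z}" C] by auto
    then have nz: "C \<noteq> {?z}" "C - {?z} \<noteq> {}" by auto
    let ?r = "mat_rank K m n ` (C - {?z})"
    have fin: "finite ?r" "?r \<noteq> {}" using mat.finite_subset_vectors[OF CV] nz by auto
    have le: "r \<le> n" if "r \<in> ?r" for r using that mat_rank_le CV by auto
    have "Min ?r = n \<longleftrightarrow> (\<forall>r\<in>?r. r = n)"
    proof
      assume "Min ?r = n"
      then show "\<forall>r\<in>?r. r = n" using le Min_le[OF fin(1)] by (metis le_antisym)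
    next
      assume "\<forall>r\<in>?r. r = n"
      then show "Min ?r = n" using Min_in[OF fin] by blast
    qed
    then show ?thesis using nz(1) sub(2) by (auto simp: rank_distance_def deficient_def)
  qed
  then show ?thesis by (auto simp: maximal_codes_def)
qed

text \<open>Settles the case outside \<open>nested_count\<close>, where \<open>1 \<le> N\<close> is
  assumed: the zero code is the only candidate.\<close>

lemma maximal_codes_trivial:
  assumes "nu_min n F n = 0"
  shows "maximal_codes K m n F n = shape_subspaces K m n F n" "card (shape_subspaces K m n F n) = 1"
proof -
  let ?z = "\<zero>\<^bsub>mat_space K m n\<^esub>"
  have "subspace K {?z} (mat_space K m n)"
    using mat.span_is_subspace[of "{}"] by (simp add: mat.span_empty)
  then have "{?z} \<in> shape_subspaces K m n F n"
    using assms mat.subspaceD(2)[OF subspace_shapes] by (simp add: shape_subspaces_eq mat.subspaces_in_def)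
  moreover have "C = {?z}" if C: "C \<in> shape_subspaces K m n F n" for C
  proof -
    have "?z \<in> C" "card C = 1"
      using C assms mat.subspaceD(2)[of C] by (simp_all add: shape_subspaces_eq mat.subspaces_in_def)
    then show ?thesis by (metis card_1_singletonE singletonD)
  qed
  ultimately have "shape_subspaces K m n F n = {{?z}}" by blast
  then show "maximal_codes K m n F n = shape_subspaces K m n F n" "card (shape_subspaces K m n F n) = 1"
    by (auto simp: maximal_codes_def)
qed

end

section \<open>Genericity\<close>

text \<open>A union bound: it will bound the probability of failure in some column by the sum over
  all columns.\<close>

lemma weierstrass_product_inequality:
  fixes x :: "'i \<Rightarrow> real"
  assumes "finite A" "\<And>i. i \<in> A \<Longrightarrow> 0 \<le> x i" "\<And>i. i \<in> A \<Longrightarrow> x i \<le> 1"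
  shows "1 - sum x A \<le> (\<Prod>i\<in>A. 1 - x i)"
  using assms
proof (induction A rule: finite_induct)
  case (insert i A)
  have "(\<Prod>j\<in>A. 1 - x j) \<le> 1" using insert by (intro prod_le_1) auto
  then have "x i * (\<Prod>j\<in>A. 1 - x j) \<le> x i" using insert.prems by (intro mult_left_le) auto
  moreover have "1 - sum x A \<le> (\<Prod>j\<in>A. 1 - x j)" using insert by auto
  ultimately show ?case using insert.hyps by (simp add: left_diff_distrib)
qed simp

text \<open>Integers modulo \<open>p\<close>, transported to natural numbers. Arbitrarily large
  fields of this kind keep the limit in \<open>generic\<close> from being vacuous.\<close>

lemma nat_field_of_prime_order:
  assumes "prime p"
  shows "\<exists>K :: nat ring. field K \<and> finite (carrier K) \<and> order K = p"
proof -
  interpret P: residues_prime p "residue_ring (int p)" by unfold_locales (use assms in auto)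
  have carrier: "carrier (residue_ring (int p)) = {0..int p - 1}" by (rule P.res_carrier_eq)
  have inj: "inj_on nat (carrier (residue_ring (int p)))"
    unfolding carrier by (auto simp: inj_on_def)
  let ?K = "image_ring nat (residue_ring (int p))"
  have "carrier ?K = nat ` {0..int p - 1}" unfolding image_ring_carrier carrier ..
  moreover have "card (nat ` {0..int p - 1}) = p"
    using card_image[OF inj] unfolding carrier by simp
  ultimately show ?thesis
    using field.inj_imp_image_ring_is_field[OF P.is_field inj] by (intro exI[of _ ?K]) (simp add: order_def)
qed

text \<open>Ensures that the code dimension does not exceed the dimension of the space of all
  matrices of the shape.\<close>

lemma nu_min_le_card:
  assumes F: "ferrers_diagram m n F" and n: "1 \<le> n"
  shows "nu_min n F n \<le> card F"
proof -
  have "nu_min n F n \<le> col_count F 1" using nu_min_le[of 0 n F] nu_0[of n F] by simp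
  also have "\<dots> \<le> card F" unfolding ferrers_card[OF F] using n by (intro member_le_sum) auto
  finally show ?thesis .
qed

section \<open>Estimates for the proportion of maximal codes\<close>

context ferrers_codes
begin

abbreviation "N \<equiv> nu_min n F n"
abbreviation "h \<equiv> staircase_height n F"
abbreviation "q \<equiv> real (order K)"

text \<open>For independent first \<open>t\<close> columns, the probability that a random element of
  \<open>flag t\<close> falls into their span.\<close>

definition column_defect :: "nat \<Rightarrow> real" where
  "column_defect t = q ^ t / q ^ col_count F (Suc t)"

lemma q_ge_2: "2 \<le> q"
  using mat.order_ge_2 by simp

lemma q_power_pos: "0 < q ^ i"
  using q_ge_2 by simp

lemma column_defect_pos: "0 < column_defect t"
  using q_power_pos by (simp add: column_defect_def)

lemma column_defect_le:
  assumes "0 < h" "t < n"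
  shows "column_defect t \<le> 1 / q ^ h" "column_defect t \<le> 1"
proof -
  have "h \<le> col_count F (Suc t) - t" using staircase_height_le[of t n F] assms by simp
  \<comment> \<open>Positivity of \<open>h\<close> excludes truncation in the preceding
    difference.\<close>
  then have "t + h \<le> col_count F (Suc t)" using assms by linarith
  then have "q ^ (t + h) \<le> q ^ col_count F (Suc t)" using q_ge_2 by (intro power_increasing) auto
  then show *: "column_defect t \<le> 1 / q ^ h"
    using q_power_pos by (simp add: column_defect_def field_simps power_add)
  have "1 \<le> q ^ h" using q_ge_2 by (intro one_le_power) auto
  then have "1 / q ^ h \<le> 1" using q_power_pos[of h] by (simp only: divide_le_eq_1_pos)
  with * show "column_defect t \<le> 1" by linarith
qed

text \<open>Each factor of the full-rank count gives off a power of \<open>q\<close>, and the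
  exponents add up to \<open>card F\<close>. The \<open>1\<close> on the left stands for the zero
  matrix.\<close>

lemma real_card_deficient:
  assumes h: "0 < h"
  shows "real (card deficient) + 1 = q ^ card F * (1 - (\<Prod>t<n. 1 - column_defect t))"
proof -
  have factor: "real (order K ^ col_count F (Suc t) - order K ^ t) = q ^ col_count F (Suc t) * (1 - column_defect t)"
    if "t < n" for t
  proof -
    have "column_defect t \<le> 1" using column_defect_le(2)[OF h that] .
    then have "q ^ t \<le> q ^ col_count F (Suc t)" using q_power_pos by (simp add: column_defect_def)
    then have "order K ^ t \<le> order K ^ col_count F (Suc t)" by (simp flip: of_nat_power)
    then show ?thesis using q_power_pos[of "col_count F (Suc t)"]
      by (simp add: of_nat_diff column_defect_def right_diff_distrib)
  qed
  have L: "card F = (\<Sum>t<n. col_count F (Suc t))"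
    unfolding ferrers_card[OF ferrers] by (simp add: sum.atLeast1_atMost_eq)
  have "real (\<Prod>t<n. order K ^ col_count F (Suc t) - order K ^ t) =
      (\<Prod>t<n. q ^ col_count F (Suc t) * (1 - column_defect t))"
    unfolding of_nat_prod using factor by (intro prod.cong) auto
  also have "\<dots> = q ^ card F * (\<Prod>t<n. 1 - column_defect t)"
    unfolding L by (simp add: prod.distrib power_sum)
  finally show ?thesis
    using arg_cong[OF card_deficient, of real] by (simp add: right_diff_distrib)
qed

text \<open>Union bound over the \<open>n\<close> columns, each with defect at most
  \<open>1 / q ^ h\<close>.\<close>

lemma card_deficient_le:
  assumes h: "0 < h"
  shows "real (card deficient) * q ^ h \<le> real n * q ^ card F"
proof -
  have "1 - (\<Sum>t<n. column_defect t) \<le> (\<Prod>t<n. 1 - column_defect t)"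
    using column_defect_pos column_defect_le(2)[OF h]
    by (intro weierstrass_product_inequality) (auto simp: less_imp_le)
  moreover have "(\<Sum>t<n. column_defect t) \<le> (\<Sum>t<n. 1 / q ^ h)"
    using column_defect_le(1)[OF h] by (intro sum_mono) auto
  ultimately have "1 - (\<Prod>t<n. 1 - column_defect t) \<le> real n / q ^ h" by simp
  then have "real (card deficient) + 1 \<le> q ^ card F * (real n / q ^ h)"
    unfolding real_card_deficient[OF h] using q_power_pos by (intro mult_left_mono) (auto simp: less_imp_le)
  then have "real (card deficient) \<le> q ^ card F * real n / q ^ h" by simp
  then show ?thesis using q_power_pos by (simp add: field_simps)
qed

text \<open>Only the column attaining the minimum in \<open>h\<close> is kept; its defect is exactly
  \<open>1 / q ^ h\<close>, and the remaining factors are at most \<open>1\<close>.\<close>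

lemma card_deficient_ge:
  assumes h: "0 < h"
  shows "q ^ card F \<le> (real (card deficient) + 1) * q ^ h"
proof -
  obtain j where j: "j \<le> n - 1" "h = col_count F (Suc j) - j" using staircase_height_attained by blast
  have jn: "j < n" using j n_pos by simp
  have "col_count F (Suc j) = j + h" using j h by simp
  then have defect: "column_defect j = 1 / q ^ h"
    using q_power_pos by (simp add: column_defect_def power_add)
  have "(\<Prod>t<n. 1 - column_defect t) = (1 - column_defect j) * (\<Prod>t\<in>{..<n} - {j}. 1 - column_defect t)"
    using jn by (intro prod.remove) auto
  also have "\<dots> \<le> (1 - column_defect j) * 1"
    using column_defect_le(2)[OF h] column_defect_pos jn
    by (intro mult_left_mono prod_le_1) (auto simp: less_imp_le)
  finally have "1 / q ^ h \<le> 1 - (\<Prod>t<n. 1 - column_defect t)" by (simp add: defect)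
  then have "q ^ card F * (1 / q ^ h) \<le> real (card deficient) + 1"
    unfolding real_card_deficient[OF h] using q_power_pos by (intro mult_left_mono) (auto simp: less_imp_le)
  then show ?thesis using q_power_pos[of h] by (simp add: field_simps)
qed

lemma deficient_subset: "deficient \<subseteq> shapes" "\<zero>\<^bsub>mat_space K m n\<^esub> \<notin> deficient"
  by (auto simp: deficient_def)

lemma nested_count_shapes:
  assumes "0 < N"
  shows "nested_count K (mat_space K m n) shapes (card F) N"
  using assms nu_min_le_card[OF ferrers n_pos]
  by (intro nested_count.intro nested_count_axioms.intro mat.finite_vectorspace_axioms
      subspace_shapes card_shapes) simp_all

abbreviation proportion :: real where
  "proportion \<equiv> real (card (maximal_codes K m n F n)) / real (card (shape_subspaces K m n F n))"

abbreviation "density \<equiv> nested_count.density K (card F) N deficient"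

text \<open>A candidate fails to be maximal exactly when it meets \<open>deficient\<close>, so the
  two bounds on \<open>hit\<close> apply to \<open>1 - proportion\<close>.\<close>

lemma proportion_bounds:
  assumes N: "0 < N"
  shows "proportion \<le> 1" "1 - proportion \<le> density"
    "density \<le> (1 + density) * (1 - proportion)"
proof -
  interpret C: nested_count K "mat_space K m n" shapes "card F" N
    by (rule nested_count_shapes[OF N])
  let ?hit = "{C \<in> mat.subspaces_in shapes N. C \<inter> deficient \<noteq> {}}"
  let ?T = "mat.subspaces_in shapes N"
  have T: "0 < real (card ?T)" using C.card_T_pos by simp
  have "maximal_codes K m n F n = ?T - ?hit"
    unfolding maximal_codes_eq[OF N] shape_subspaces_eq by blast
  then have card_max: "real (card (maximal_codes K m n F n)) = real (card ?T) - real (card ?hit)"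
    using C.finite_T by (simp add: card_Diff_subset of_nat_diff card_mono)
  have eq: "1 - proportion = real (card ?hit) / real (card ?T)"
    unfolding card_max shape_subspaces_eq using T by (simp add: diff_divide_distrib)
  have "0 \<le> 1 - proportion" unfolding eq by simp
  then show "proportion \<le> 1" by linarith
  show "1 - proportion \<le> density"
    using C.card_hit_le[OF deficient_subset deficient_smult] T unfolding eq by (simp add: pos_divide_le_eq)
  show "density \<le> (1 + density) * (1 - proportion)"
    using C.card_hit_ge[OF deficient_subset deficient_smult] T unfolding eq by (simp add: field_simps)
qed

text \<open>There are at most \<open>n * q ^ (card F - h)\<close> deficient matrices and
  \<open>ratio\<close> is at most \<open>q ^ N / q ^ card F\<close>; for \<open>N = h\<close> the
  powers cancel.\<close>

lemma density_le:
  assumes N: "0 < N" "N = h"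
  shows "density \<le> real n / (q - 1)"
proof -
  interpret C: nested_count K "mat_space K m n" shapes "card F" N
    by (rule nested_count_shapes[OF N(1)])
  have "1 < q ^ card F" using C.NL q_ge_2 by (intro one_less_power) auto
  have "(q ^ N - 1) * q ^ card F \<le> q ^ N * (q ^ card F - 1)"
    using mat.power_order_le[OF C.NL(2)] by (simp add: algebra_simps)
  then have "C.ratio \<le> q ^ N / q ^ card F"
    unfolding C.ratio_def using \<open>1 < q ^ card F\<close> q_power_pos[of "card F"]
    by (simp add: pos_divide_le_eq pos_le_divide_eq)
  then have "real (card deficient) * C.ratio \<le> real (card deficient) * (q ^ N / q ^ card F)"
    by (rule mult_left_mono) simp
  also have "\<dots> \<le> real n"
    using card_deficient_le N q_power_pos[of "card F"] by (simp add: field_simps)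
  finally have "real (card deficient) * C.ratio \<le> real n" .
  then have "C.density deficient \<le> real n / (q - 1)"
    unfolding C.density_def using q_ge_2 by (intro divide_right_mono) auto
  then show ?thesis .
qed

text \<open>Replacing \<open>q ^ (card F - h) - 1\<close> and \<open>q ^ N - 1\<close> by half of
  the respective powers costs a factor \<open>2\<close> each, hence \<open>1 / 4\<close>.\<close>

lemma density_ge:
  assumes N: "0 < N" "h < N"
  shows "1 / 4 \<le> density"
proof -
  interpret C: nested_count K "mat_space K m n" shapes "card F" N
    by (rule nested_count_shapes[OF N(1)])
  let ?L = "card F" and ?b = "real (card deficient)"
  have h: "0 < h" using staircase_height_pos[OF ferrers n_pos N(1)] .
  have half: "q ^ i / 2 \<le> q ^ i - 1" if "0 < i" for i
  proof -
    have "q \<le> q ^ i" using q_ge_2 that by (intro self_le_power) auto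
    then show ?thesis using q_ge_2 by linarith
  qed
  have "q ^ (?L - h) * q ^ h \<le> (?b + 1) * q ^ h"
    using card_deficient_ge[OF h] N(2) C.NL(2) by (simp flip: power_add)
  then have "q ^ (?L - h) \<le> ?b + 1" using q_power_pos by (simp only: mult_le_cancel_right_pos)
  then have b: "q ^ (?L - h) / 2 \<le> ?b" using half[of "?L - h"] N(2) C.NL(2) by simp
  have "(q - 1) * q ^ ?L \<le> q * q ^ ?L" using q_power_pos by (intro mult_right_mono) (auto simp: less_imp_le)
  also have "\<dots> = q ^ Suc ?L" by simp
  \<comment> \<open>Here \<open>h < N\<close> enters: it supplies the additional factor
    \<open>q\<close> that absorbs \<open>q - 1\<close>.\<close>
  also have "\<dots> \<le> q ^ ((?L - h) + N)" using N(2) C.NL(2) q_ge_2 by (intro power_increasing) auto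
  also have "\<dots> = 4 * ((q ^ (?L - h) / 2) * (q ^ N / 2))" by (simp add: power_add)
  also have "\<dots> \<le> 4 * (?b * (q ^ N - 1))"
    using b half[OF N(1)] q_power_pos by (intro mult_left_mono mult_mono) (auto simp: less_imp_le)
  finally have "(q - 1) * q ^ ?L \<le> 4 * (?b * (q ^ N - 1))" .
  moreover have "(q - 1) * (q ^ ?L - 1) \<le> (q - 1) * q ^ ?L" using q_ge_2 by (intro mult_left_mono) auto
  ultimately have main: "(q - 1) * (q ^ ?L - 1) \<le> 4 * (?b * (q ^ N - 1))" by linarith
  have "1 < q ^ ?L" using C.NL q_ge_2 by (intro one_less_power) auto
  then have pos: "0 < (q - 1) * (q ^ ?L - 1)" using q_ge_2 by simp
  have "C.density deficient = ?b * (q ^ N - 1) / ((q - 1) * (q ^ ?L - 1))"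
    unfolding C.density_def C.ratio_def by simp
  then show ?thesis using main pos by (simp add: pos_le_divide_eq)
qed

lemma proportion_near_1:
  assumes "N = h"
  shows "\<bar>proportion - 1\<bar> \<le> real n / (q - 1)"
proof (cases "N = 0")
  case True
  have "proportion = 1" using maximal_codes_trivial[OF True] by simp
  then show ?thesis using q_ge_2 by simp
next
  case False
  then show ?thesis using proportion_bounds density_le assms by fastforce
qed

text \<open>The lower bound \<open>density / (1 + density)\<close> increases with the density and
  equals \<open>1 / 5\<close> at \<open>1 / 4\<close>.\<close>

lemma proportion_away_from_1:
  assumes "h < N"
  shows "1 / 5 \<le> \<bar>proportion - 1\<bar>"
proof -
  have N: "0 < N" using assms by simp
  have d: "1 / 4 \<le> density" using density_ge[OF N assms] .
  show ?thesis
  proof (rule ccontr)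
    assume "\<not> ?thesis"
    then have "1 - proportion < 1 / 5" by linarith
    then have "(1 + density) * (1 - proportion) < (1 + density) * (1 / 5)"
      using d by (intro mult_strict_left_mono) auto
    from le_less_trans[OF proportion_bounds(3)[OF N] this] show False using d by (simp add: field_simps)
  qed
qed

end

lemma generic_iff_staircase_height:
  assumes F: "ferrers_diagram m n F" and n: "1 \<le> n"
  shows "generic m n F n \<longleftrightarrow> nu_min n F n = staircase_height n F"
proof
  assume gen: "generic m n F n"
  show "nu_min n F n = staircase_height n F"
  proof (rule ccontr)
    assume "nu_min n F n \<noteq> staircase_height n F"
    then have less: "staircase_height n F < nu_min n F n"
      using staircase_height_le_nu_min[of n F] by simp
    obtain Q where Q: "\<And>K :: nat ring. field K \<and> finite (carrier K) \<and> Q \<le> order K \<Longrightarrow>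
        \<bar>real (card (maximal_codes K m n F n)) / real (card (shape_subspaces K m n F n)) - 1\<bar> < 1 / 5"
      using gen[unfolded generic_iff, rule_format, of "1 / 5"] by auto
    obtain p where p: "prime p" "Q < p" using bigger_prime by blast
    then obtain K :: "nat ring" where K: "field K" "finite (carrier K)" "order K = p"
      using nat_field_of_prime_order by blast
    interpret field K by (rule K)
    interpret ferrers_codes K m n F using K F n by unfold_locales auto
    show False using proportion_away_from_1[OF less] Q[of K] K p by simp
  qed
next
  assume eq: "nu_min n F n = staircase_height n F"
  show "generic m n F n"
    unfolding generic_iff
  proof (intro allI impI)
    fix \<epsilon> :: real assume \<epsilon>: "0 < \<epsilon>"
    show "\<exists>Q. \<forall>K :: nat ring. field K \<and> finite (carrier K) \<and> Q \<le> order K \<longrightarrow>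
      \<bar>real (card (maximal_codes K m n F n)) / real (card (shape_subspaces K m n F n)) - 1\<bar> < \<epsilon>"
    \<comment> \<open>The summand \<open>2\<close> makes \<open>order K - 1\<close> strictly larger
      than \<open>n / \<epsilon>\<close>.\<close>
    proof (intro exI[of _ "nat \<lceil>real n / \<epsilon>\<rceil> + 2"] allI impI, elim conjE)
      fix K :: "nat ring"
      assume K: "field K" "finite (carrier K)" "nat \<lceil>real n / \<epsilon>\<rceil> + 2 \<le> order K"
      interpret field K by (rule K)
      interpret ferrers_codes K m n F using K F n by unfold_locales auto
      have "real n / \<epsilon> \<le> real (nat \<lceil>real n / \<epsilon>\<rceil>)" by (rule real_nat_ceiling_ge)
      also have "\<dots> < real (order K) - 1" using K(3) by linarith
      finally have "real n / (real (order K) - 1) < \<epsilon>"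
        using \<epsilon> q_ge_2 by (simp add: field_simps)
      then show "\<bar>proportion - 1\<bar> < \<epsilon>" using proportion_near_1[OF eq] by linarith
    qed
  qed
qed

text \<open>In the last clause \<open>0 < nu_min n F n\<close> excludes the zero code: for empty
  \<open>F\<close> and \<open>1 < n\<close> all \<open>nu\<close> vanish, the pair is constructible,
  and the strict inequalities fail.\<close>

theorem corollary6p13:
  fixes m n :: nat and F :: "(nat \<times> nat) set"
  assumes "1 \<le> n" and "n \<le> m" and "ferrers_diagram m n F"
  shows "(generic m n F n \<longleftrightarrow> mds_constructible m n F n) \<and>
         (1 < n \<longrightarrow> \<not> generic m n ({1..m} \<times> {1..n}) n) \<and>
         (mds_constructible m n F n \<and> 0 < nu_min n F n \<longrightarrow>
            nu_min n F n = 1 \<or>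
            (nu_min n F n = nu n F n 0 \<and> nu n F n 0 = col_count F 1 \<and>
             (\<forall>j \<in> {1..n - 1}. col_count F 1 < nu n F n j)))"
proof (intro conjI impI)
  have iff: "generic m n D n \<longleftrightarrow> mds_constructible m n D n" if "ferrers_diagram m n D" for D
    using generic_iff_staircase_height[OF that] mds_constructible_iff[OF that] assms(1) by simp
  show "generic m n F n \<longleftrightarrow> mds_constructible m n F n" using iff assms(3) .
  show "\<not> generic m n ({1..m} \<times> {1..n}) n" if "1 < n"
    using iff[OF ferrers_full] full_not_mds_constructible[OF that assms(2)] by simp
  assume "mds_constructible m n F n \<and> 0 < nu_min n F n"
  then show "nu_min n F n = 1 \<or>
      (nu_min n F n = nu n F n 0 \<and> nu n F n 0 = col_count F 1 \<and>
       (\<forall>j \<in> {1..n - 1}. col_count F 1 < nu n F n j))"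
    using mds_constructible_nu[OF assms(3,1)] nu_0[of n F] by blast
qed

end
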